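(* Let $\Sigma$ be an input-accessible network system. Then $\Sigma$ is not structurally controllable if and only if every set of stems and cycles covering the state nodes of $\mathrm G(\Sigma)$ includes one of the following: 1) a stem and a cycle intersecting at some node $w$; 2) two cycles intersecting at some node $w$; 3) two stems, intersecting at some node $w$, originated from different input nodes; 4) two stems originated from the same input node.
   Context: **Network.** $\Sigma$ is the structured system $\dot x=Ax+Bu$, $y=x$, with $x\in\mathbb{R}^n$, $u\in\mathbb{R}^m$. Each entry of $A\in\mathbb{R}^{n\times n}$ and $B\in\mathbb{R}^{n\times m}$ is either fixed to zero or a free (independent, arbitrary real) parameter, and all diagonal entries of $A$ are fixed to zero. For entries of a structured matrix, "$\neq 0$" means "is a free parameter". **Structural controllability.** $\Sigma$ is structurally controllable if for some choice of the free parameters $[B\ AB\ \cdots\ A^{n-1}B]$ has full row rank. **Graph.** $\mathrm G(\Sigma)$ is the directed graph whose nodes are the state nodes $x_1,\dots,x_n$ and the input nodes $u_1,\dots,u_m$, with an edge $(x_i,x_j)$ iff $A_{ji}\ne0$ and an edge $(u_i,x_j)$ iff $B_{ji}\neq0$. A stem is a sequence of distinct nodes $v_1,\dots,v_\ell$ with $(v_k,v_{k+1})$ an edge for all $k$, $v_1$ an input node and $v_\ell$ a state node. A cycle is a closed sequence $v_1,\dots,v_\ell=v_1$ with $(v_k,v_{k+1})$ an edge for all $k$ and $v_1,\dots,v_{\ell-1}$ distinct. A set of stems and cycles covers a set of nodes if each of these nodes lies on some member. $\Sigma$ is input-accessible if every state node is the end vertex of a stem. Two stems (or two cycles) means two distinct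 ones, cycles being identified up to the choice of starting node; intersecting means sharing a node. *)

theory Defs
  imports
    "Graph_Theory.Graph_Theory"
    "Jordan_Normal_Form.DL_Rank"
begin

text \<open>
  A structured matrix is a Boolean matrix: the entry is \<open>True\<close> where the matrix has a free
  parameter and \<open>False\<close> where it is fixed to zero. Indices start at \<open>0\<close>.
\<close>

definition network_system :: "nat \<Rightarrow> nat \<Rightarrow> bool mat \<Rightarrow> bool mat \<Rightarrow> bool" where
  "network_system n m A B \<longleftrightarrow>
     A \<in> carrier_mat n n \<and> B \<in> carrier_mat n m \<and> (\<forall>i<n. \<not> A $$ (i, i))"

definition realizes :: "real mat \<Rightarrow> bool mat \<Rightarrow> bool" where
  "realizes M P \<longleftrightarrow> M \<in> carrier_mat (dim_row P) (dim_col P) \<and>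
     (\<forall>i<dim_row P. \<forall>j<dim_col P. \<not> P $$ (i, j) \<longrightarrow> M $$ (i, j) = 0)"

text \<open>The block matrix \<open>[B  AB  \<dots>  A^(n-1)B]\<close>: column \<open>k * m + l\<close> is column \<open>l\<close> of \<open>A^k B\<close>.\<close>

definition controllability_matrix :: "real mat \<Rightarrow> real mat \<Rightarrow> real mat" where
  "controllability_matrix A B =
     (let n = dim_row B; m = dim_col B
      in mat n (n * m) (\<lambda>(i, j). (A ^\<^sub>m (j div m) * B) $$ (i, j mod m)))"

definition full_row_rank :: "real mat \<Rightarrow> bool" where
  "full_row_rank M \<longleftrightarrow> vec_space.rank (dim_row M) M = dim_row M"

definition structurally_controllable :: "bool mat \<Rightarrow> bool mat \<Rightarrow> bool" where
  "structurally_controllable A B \<longleftrightarrow>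
     (\<exists>A' B'. realizes A' A \<and> realizes B' B \<and> full_row_rank (controllability_matrix A' B'))"

datatype node = State nat | Input nat

definition state_nodes :: "bool mat \<Rightarrow> node set" where
  "state_nodes A = State ` {..<dim_row A}"

definition input_nodes :: "bool mat \<Rightarrow> node set" where
  "input_nodes B = Input ` {..<dim_col B}"

definition system_graph :: "bool mat \<Rightarrow> bool mat \<Rightarrow> node pair_pre_digraph" where
  "system_graph A B =
     \<lparr> pverts = state_nodes A \<union> input_nodes B,
       parcs = {(State i, State j) | i j. i < dim_col A \<and> j < dim_row A \<and> A $$ (j, i)}
             \<union> {(Input i, State j) | i j. i < dim_col B \<and> j < dim_row B \<and> B $$ (j, i)} \<rparr>"

definition stem :: "bool mat \<Rightarrow> bool mat \<Rightarrow> node list \<Rightarrow> bool" where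
  "stem A B p \<longleftrightarrow> vpath p (system_graph A B) \<and> hd p \<in> input_nodes B \<and> last p \<in> state_nodes A"

text \<open>
  A cycle is written with its starting node repeated at the end. The length condition excludes
  the closed sequence consisting of one node and no edge.
\<close>

definition graph_cycle :: "bool mat \<Rightarrow> bool mat \<Rightarrow> node list \<Rightarrow> bool" where
  "graph_cycle A B c \<longleftrightarrow> vwalk c (system_graph A B) \<and> length c \<ge> 2 \<and> hd c = last c \<and>
     distinct (butlast c)"

definition same_cycle :: "node list \<Rightarrow> node list \<Rightarrow> bool" where
  "same_cycle c d \<longleftrightarrow> (\<exists>k. butlast d = rotate k (butlast c))"

definition input_accessible :: "bool mat \<Rightarrow> bool mat \<Rightarrow> bool" where
  "input_accessible A B \<longleftrightarrow> (\<forall>x \<in> state_nodes A. \<exists>p. stem A B p \<and> last p = x)"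

definition covers :: "node list set \<Rightarrow> node set \<Rightarrow> bool" where
  "covers F X \<longleftrightarrow> (\<forall>x \<in> X. \<exists>p \<in> F. x \<in> set p)"

end

theory Submission
  imports Defs "HOL-Combinatorics.Orbits"
begin

text \<open>
  A disjoint family of stems and cycles covering the states amounts to an injective choice of a
  predecessor node \<open>f j\<close> for every state \<open>j\<close>. If a realization is controllable then \<open>[A B]\<close> has
  independent rows, and independent rows have a system of distinct nonzero entries, which is such a
  choice. Conversely, put weight one on the stems of \<open>f\<close>, which makes their states controllable, and
  then attach the cycles of \<open>f\<close> one at a time, each with a single further arc from the part already
  built (this is where accessibility enters) and with a weight \<open>\<gamma>\<close> on the cycle. A nonzero state that
  is never seen by the inputs under the transposed dynamics would grow at rate \<open>\<gamma>\<close> along the cycle,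
  but the growth rate possible in the part already built does not depend on \<open>\<gamma>\<close>; so a large \<open>\<gamma>\<close> works.
\<close>

section \<open>Silent trajectories and attaching a cycle\<close>

text \<open>No eigenvalue is used: silence is a property of whole real trajectories. The obstacle is
  that a signal entering the built part from a new cycle might a priori drive it at any rate, so
  that the growth bound would depend on what is attached. Silence removes this freedom. The outputs
  of the built part answer an injected signal after a fixed delay with a nonzero factor, so keeping
  them at zero forces the signal to be a fixed linear function of the states. The built part then
  moves as a closed loop whose coefficients are known before \<gamma> is chosen; every cycle gets
  its own \<gamma>, one more than the sum of the absolute values of these coefficients. That only
  \<open>[A B]\<close> matters in the opposite direction has a dual reason: a vector annihilated
  from the left by both matrices is a silent trajectory that dies after one step.\<close>

text \<open>The dual form of controllability: \<open>W v j\<close> is the weight of the arc from \<open>v\<close> to \<open>State j\<close>, and \<open>X\<close> runs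
  through the trajectories of the transposed system whose output at every input node vanishes.\<close>
definition controllable_on :: "nat set \<Rightarrow> nat set \<Rightarrow> (node \<Rightarrow> nat \<Rightarrow> real) \<Rightarrow> bool" where
  "controllable_on S I W \<longleftrightarrow>
     (\<forall>X. (\<forall>t. \<forall>i\<in>S. X (Suc t) i = (\<Sum>j\<in>S. W (State i) j * X t j)) \<longrightarrow>
          (\<forall>t. \<forall>l\<in>I. (\<Sum>j\<in>S. W (Input l) j * X t j) = 0) \<longrightarrow>
          (\<forall>t. \<forall>i\<in>S. X t i = (0 :: real)))"

lemma controllable_onD:
  assumes "controllable_on S I W"
    and "\<And>t i. i \<in> S \<Longrightarrow> X (Suc t) i = (\<Sum>j\<in>S. W (State i) j * X t j)"
    and "\<And>t l. l \<in> I \<Longrightarrow> (\<Sum>j\<in>S. W (Input l) j * X t j) = 0"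
    and "i \<in> S"
  shows "X t i = 0"
  using assms unfolding controllable_on_def by blast

text \<open>Composing a functional with \<open>T\<close> multiplies its coefficient row by
  \<open>M\<close>. This yields feedback coefficients that depend on neither the trajectory nor the
  time.\<close>

lemma linear_funpow_functional:
  fixes M :: "'a \<Rightarrow> 'a \<Rightarrow> real" and S :: "'a set"
  defines "T \<equiv> \<lambda>x i. \<Sum>j\<in>S. M i j * x j"
  shows "\<exists>c'. \<forall>x. (\<Sum>j\<in>S. c j * (T ^^ r) x j) = (\<Sum>j\<in>S. c' j * x j)"
proof (induction r)
  case (Suc r)
  then obtain c' where c': "\<And>x. (\<Sum>j\<in>S. c j * (T ^^ r) x j) = (\<Sum>j\<in>S. c' j * x j)"
    by blast
  have "(\<Sum>j\<in>S. c j * (T ^^ Suc r) x j) = (\<Sum>j\<in>S. (\<Sum>i\<in>S. c' i * M i j) * x j)" for x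
  proof -
    have "(\<Sum>j\<in>S. c j * (T ^^ Suc r) x j) = (\<Sum>i\<in>S. c' i * T x i)"
      using c'[of "T x"] by (simp add: funpow_swap1)
    also have "\<dots> = (\<Sum>i\<in>S. \<Sum>j\<in>S. c' i * M i j * x j)"
      by (simp add: T_def sum_distrib_left mult.assoc)
    also have "\<dots> = (\<Sum>j\<in>S. \<Sum>i\<in>S. c' i * M i j * x j)"
      by (rule sum.swap)
    finally show ?thesis by (simp add: sum_distrib_right)
  qed
  then show ?case by (intro exI[of _ "\<lambda>j. \<Sum>i\<in>S. c' i * M i j"] allI)
qed auto

text \<open>The first nonvanishing Markov parameter from \<open>s\<close> to the input nodes turns the signal injected
  at \<open>s\<close> into a static feedback of the states.\<close>
lemma injected_signal_is_feedback:
  assumes ctrb: "controllable_on S I W"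
    and s: "s \<in> State ` S \<union> Input ` I"
  shows "\<exists>g. \<forall>X u.
          (\<forall>t. \<forall>i\<in>S. X (Suc t) i = (\<Sum>j\<in>S. W (State i) j * X t j) + (if s = State i then u t else 0)) \<longrightarrow>
          (\<forall>t. \<forall>l\<in>I. (\<Sum>j\<in>S. W (Input l) j * X t j) + (if s = Input l then u t else 0) = 0) \<longrightarrow>
          (\<forall>t. u t = (\<Sum>j\<in>S. g j * X t j))"
proof (cases s)
  case (Input l)
  then have l: "l \<in> I" using s by auto
  show ?thesis
  proof (intro exI[of _ "\<lambda>j. - W s j"] allI impI)
    fix X :: "nat \<Rightarrow> nat \<Rightarrow> real" and u t
    assume "\<forall>t. \<forall>l\<in>I. (\<Sum>j\<in>S. W (Input l) j * X t j) + (if s = Input l then u t else 0) = 0"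
    then have "(\<Sum>j\<in>S. W (Input l) j * X t j) + u t = 0" using l Input by force
    then show "u t = (\<Sum>j\<in>S. - W s j * X t j)" by (simp add: Input sum_negf)
  qed
next
  case (State i)
  then have i: "i \<in> S" using s by auto
  define T where "T = (\<lambda>x k. \<Sum>j\<in>S. W (State k) j * x j)"
  define e where "e = (\<lambda>k. if k = i then 1 else (0::real))"
  define phi where "phi = (\<lambda>l x. \<Sum>j\<in>S. W (Input l) j * x j)"
  have lin: "(T ^^ r) (\<lambda>k. x k + c * y k) = (\<lambda>k. (T ^^ r) x k + c * (T ^^ r) y k)" for r c x y
  proof (induction r)
    case (Suc r)
    then show ?case
      by (simp add: T_def fun_eq_iff sum.distrib algebra_simps sum_distrib_left)
  qed simp
  have cong: "T x = T y" "phi l x = phi l y" if "\<And>k. k \<in> S \<Longrightarrow> x k = y k" for x y l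
    using that by (simp_all add: T_def phi_def)
  \<comment> \<open>States are functions on all of \<open>nat\<close>, but the dynamics fixes them
    only on \<open>S\<close>; the outputs do not see the difference.\<close>
  have congr: "phi l ((T ^^ r) x) = phi l ((T ^^ r) y)" if "\<And>k. k \<in> S \<Longrightarrow> x k = y k" for x y l r
  proof (cases r)
    case 0
    then show ?thesis using cong(2)[OF that] by simp
  next
    case (Suc r')
    then show ?thesis using cong(1)[OF that] by (simp add: funpow_Suc_right del: funpow.simps(2))
  qed
  \<comment> \<open>If every Markov parameter from \<open>s\<close> vanished, the free motion
    started at the unit vector \<open>e\<close> would be silent although
    \<open>e i = 1\<close>.\<close>
  have "\<exists>l\<in>I. \<exists>t. phi l ((T ^^ t) e) \<noteq> 0"
  proof (rule ccontr)
    assume "\<not> ?thesis"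
    then have "(T ^^ 0) e i = 0"
      by (intro controllable_onD[OF ctrb, of "\<lambda>t. (T ^^ t) e"]) (auto simp: i T_def phi_def)
    then show False by (simp add: e_def)
  qed
  then obtain l t0 where l: "l \<in> I" and t0: "phi l ((T ^^ t0) e) \<noteq> 0" by blast
  define tau where "tau = (LEAST t. phi l ((T ^^ t) e) \<noteq> 0)"
  define h where "h = phi l ((T ^^ tau) e)"
  have h: "h \<noteq> 0" unfolding h_def tau_def by (rule LeastI, rule t0)
  have before: "phi l ((T ^^ r) e) = 0" if "r < tau" for r
    using not_less_Least that unfolding tau_def by blast
  obtain c where c: "\<And>x. phi l ((T ^^ Suc tau) x) = (\<Sum>j\<in>S. c j * x j)"
    using linear_funpow_functional[where M = "\<lambda>i. W (State i)" and c = "W (Input l)" and r = "Suc tau"]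
    unfolding phi_def T_def by blast
  \<comment> \<open>The witness solves \<open>phi l ((T ^^ tau) (X (Suc t))) = 0\<close> for
    \<open>u t\<close>: expanded by one time step, this equation contains the signal with the
    nonzero factor \<open>h\<close>.\<close>
  show ?thesis
  proof (intro exI[of _ "\<lambda>j. - c j / h"] allI impI)
    fix X u t
    assume dyn: "\<forall>t. \<forall>i\<in>S. X (Suc t) i = (\<Sum>j\<in>S. W (State i) j * X t j) + (if s = State i then u t else 0)"
      and out: "\<forall>t. \<forall>l\<in>I. (\<Sum>j\<in>S. W (Input l) j * X t j) + (if s = Input l then u t else 0) = 0"
    have step: "phi l ((T ^^ r) (X (Suc t))) = phi l ((T ^^ Suc r) (X t)) + u t * phi l ((T ^^ r) e)" for r t
    proof -
      have "phi l ((T ^^ r) (X (Suc t))) = phi l ((T ^^ r) (\<lambda>k. T (X t) k + u t * e k))"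
        by (rule congr) (use dyn State in \<open>auto simp: T_def e_def\<close>)
      also have "\<dots> = phi l ((T ^^ r) (T (X t))) + u t * phi l ((T ^^ r) e)"
        unfolding lin by (simp add: phi_def algebra_simps sum.distrib sum_distrib_left)
      finally show ?thesis by (simp add: funpow_swap1)
    qed
    \<comment> \<open>Silence is the case of power 0, nothing being injected at an input node since
      \<open>s\<close> is a state. Below \<open>tau\<close> the signal enters \<open>step\<close>
      with coefficient zero.\<close>
    have zero: "phi l ((T ^^ r) (X t)) = 0" if "r \<le> tau" for r t
      using that
    proof (induction r arbitrary: t)
      case 0
      then show ?case using out l State by (auto simp: phi_def)
    next
      case (Suc r)
      then show ?case using step[of r t] before[of r] by simp
    qed
    have "phi l ((T ^^ Suc tau) (X t)) + u t * h = 0"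
      using step[of tau t] zero[of tau "Suc t"] by (simp add: h_def)
    then have "(\<Sum>j\<in>S. c j * X t j) + u t * h = 0" by (simp only: c)
    then have "u t = - (\<Sum>j\<in>S. c j * X t j) / h" using h by (simp add: field_simps eq_neg_iff_add_eq_0)
    then show "u t = (\<Sum>j\<in>S. - c j / h * X t j)" by (simp add: sum_divide_distrib sum_negf)
  qed
qed

text \<open>Around the cycle every silent trajectory satisfies \<open>X (t + k) = \<gamma> ^ k X t\<close>,
  where \<open>k\<close> is a period of the cycle, whereas on \<open>S\<close> it
  cannot grow faster than a constant that does not depend on \<open>\<gamma>\<close>.\<close>
lemma controllable_on_attach_cycle:
  fixes p :: "nat \<Rightarrow> nat"
  assumes fin: "finite S" and ctrb: "controllable_on S I W"
    and supp: "\<And>v j. W v j \<noteq> 0 \<Longrightarrow> j \<in> S \<and> v \<in> State ` S \<union> Input ` I"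
    and s: "s \<in> State ` S \<union> Input ` I"
    and cyc: "cyclic_on p K" and inj: "inj p" and disj: "S \<inter> K = {}" and a: "a \<in> K"
  shows "\<exists>W'. (\<forall>v j. W' v j \<noteq> 0 \<longrightarrow> W v j \<noteq> 0 \<or> j \<in> K \<and> v = State (p j) \<or> v = s \<and> j = a) \<and>
    controllable_on (S \<union> K) I W'"
proof -
  obtain g where g: "\<And>X u t.
          (\<And>t i. i \<in> S \<Longrightarrow> X (Suc t) i = (\<Sum>j\<in>S. W (State i) j * X t j) + (if s = State i then u t else 0)) \<Longrightarrow>
          (\<And>t l. l \<in> I \<Longrightarrow> (\<Sum>j\<in>S. W (Input l) j * X t j) + (if s = Input l then u t else 0) = 0) \<Longrightarrow>
          u t = (\<Sum>j\<in>S. g j * X t j)"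
    using injected_signal_is_feedback[OF ctrb s] by meson
  \<comment> \<open>The absolute values of all closed-loop coefficients. The feedback
    \<open>g\<close> is charged to every row although it acts on at most one; nothing here involves
    the cycle.\<close>
  define C where "C = (\<Sum>i\<in>S. \<Sum>j\<in>S. \<bar>W (State i) j\<bar> + \<bar>g j\<bar>)"
  have C: "C \<ge> 0" unfolding C_def by (intro sum_nonneg) auto
  define \<gamma> where "\<gamma> = C + 1"
  \<comment> \<open>Columns in \<open>K\<close> are overwritten outright; by \<open>supp\<close> and
    \<open>disj\<close> the old weights vanish there.\<close>
  define W' where "W' = (\<lambda>v j. if j \<in> K then (if v = State (p j) then \<gamma> else if v = s \<and> j = a then 1 else 0) else W v j)"
  have finK: "finite K" using cyc by (rule finite_cyclic_on)
  have pK: "p j \<in> K" if "j \<in> K" for j using cyclic_on_inI[OF cyc that] .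
  have sum': "(\<Sum>j\<in>S \<union> K. W' v j * x j) = (\<Sum>j\<in>S. W v j * x j) + (\<Sum>j\<in>K. W' v j * x j)" for v x
  proof -
    have "(\<Sum>j\<in>S \<union> K. W' v j * x j) = (\<Sum>j\<in>S. W' v j * x j) + (\<Sum>j\<in>K. W' v j * x j)"
      by (rule sum.union_disjoint[OF fin finK disj])
    moreover have "(\<Sum>j\<in>S. W' v j * x j) = (\<Sum>j\<in>S. W v j * x j)"
      using disj by (intro sum.cong) (auto simp: W'_def)
    ultimately show ?thesis by simp
  qed
  have sumS: "(\<Sum>j\<in>K. W' v j * x j) = (if s = v then x a else 0)" if "v \<in> State ` S \<union> Input ` I" for v x
  proof -
    have "(\<Sum>j\<in>K. W' v j * x j) = (\<Sum>j\<in>K. if j = a then (if s = v then x a else 0) else 0)"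
      using that pK disj by (intro sum.cong) (auto simp: W'_def)
    then show ?thesis using a finK by simp
  qed
  have sumK: "(\<Sum>j\<in>S \<union> K. W' (State (p k)) j * x j) = \<gamma> * x k" if k: "k \<in> K" for k x
  proof -
    have "p k \<notin> S" using pK[OF k] disj by auto
    then have "W (State (p k)) j = 0" for j using supp[of "State (p k)" j] by auto
    moreover have "(\<Sum>j\<in>K. W' (State (p k)) j * x j) = (\<Sum>j\<in>K. if j = k then \<gamma> * x k else 0)"
      using s disj pK[OF k] k by (intro sum.cong) (auto simp: W'_def inj_eq[OF inj])
    ultimately show ?thesis using k finK by (simp add: sum')
  qed
  have "controllable_on (S \<union> K) I W'"
    unfolding controllable_on_def
  proof (intro allI impI)
    fix X and t0 :: nat
    assume dyn: "\<forall>t. \<forall>i\<in>S \<union> K. X (Suc t) i = (\<Sum>j\<in>S \<union> K. W' (State i) j * X t j)"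
      and out: "\<forall>t. \<forall>l\<in>I. (\<Sum>j\<in>S \<union> K. W' (Input l) j * X t j) = 0"
    have dynS: "X (Suc t) i = (\<Sum>j\<in>S. W (State i) j * X t j) + (if s = State i then X t a else 0)" if "i \<in> S" for t i
      using dyn that by (simp add: sum' sumS)
    have outS: "(\<Sum>j\<in>S. W (Input l) j * X t j) + (if s = Input l then X t a else 0) = 0" if "l \<in> I" for t l
      using out that by (simp add: sum' sumS)
    \<comment> \<open>The transposed system carries values from the head of an arc to its tail,
      hence from \<open>j\<close> to its predecessor \<open>p j\<close>.\<close>
    have dynK: "X (Suc t) (p j) = \<gamma> * X t j" if "j \<in> K" for t j
      using dyn pK[OF that] sumK[OF that] by simp
    have iter: "(p ^^ r) j \<in> K \<and> X (t + r) ((p ^^ r) j) = \<gamma> ^ r * X t j" if "j \<in> K" for r t j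
    proof (induction r)
      case (Suc r)
      then show ?case using dynK[of "(p ^^ r) j" "t + r"] pK by simp
    qed (use that in simp)
    have orb: "\<exists>r>0. (p ^^ r) i = j" if "i \<in> K" "j \<in> K" for i j
      using that cyc unfolding cyclic_on_alldef orbit_altdef by auto
    obtain k where k: "k > 0" "(p ^^ k) a = a" using orb a by blast
    have per_a: "X (t + k) a = \<gamma> ^ k * X t a" for t using iter[OF a, of k t] k by simp
    have shift: "(\<Sum>j\<in>S. W v j * (X (t + k) j - \<gamma> ^ k * X t j)) =
        (\<Sum>j\<in>S. W v j * X (t + k) j) - \<gamma> ^ k * (\<Sum>j\<in>S. W v j * X t j)" for v t
      by (simp add: sum_subtractf sum_distrib_left algebra_simps)
    \<comment> \<open>By \<open>per_a\<close> the injected terms cancel in the difference of the two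
      sides. It is therefore a silent trajectory of \<open>S\<close> alone, which
      \<open>ctrb\<close> forces to be zero.\<close>
    have per: "X (t + k) i = \<gamma> ^ k * X t i" if "i \<in> S" for t i
    proof -
      have "(\<lambda>t i. X (t + k) i - \<gamma> ^ k * X t i) t i = 0"
      proof (rule controllable_onD[OF ctrb _ _ that])
        show "X (Suc t + k) i - \<gamma> ^ k * X (Suc t) i
            = (\<Sum>j\<in>S. W (State i) j * (X (t + k) j - \<gamma> ^ k * X t j))" if "i \<in> S" for t i
          unfolding shift add_Suc dynS[OF that] by (simp add: per_a right_diff_distrib distrib_left)
        show "(\<Sum>j\<in>S. W (Input l) j * (X (t + k) j - \<gamma> ^ k * X t j)) = 0" if "l \<in> I" for t l
        proof -
          have "(\<Sum>j\<in>S. W (Input l) j * X t j) = (if s = Input l then - X t a else 0)" for t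
            using outS[OF that, of t] by (auto split: if_splits)
          then show ?thesis by (simp add: shift per_a)
        qed
      qed
      then show ?thesis by simp
    qed
    have u: "X t a = (\<Sum>j\<in>S. g j * X t j)" for t
      by (rule g) (use dynS outS in auto)
    define N where "N = (\<lambda>t. \<Sum>i\<in>S. \<bar>X t i\<bar>)"
    have N0: "N t \<ge> 0" for t unfolding N_def by (rule sum_nonneg) simp
    have Ni: "\<bar>X t i\<bar> \<le> N t" if "i \<in> S" for t i
      unfolding N_def using fin that by (intro member_le_sum) auto
    have grow: "N (Suc t) \<le> C * N t" for t
    proof -
      have "\<bar>X (Suc t) i\<bar> \<le> (\<Sum>j\<in>S. \<bar>W (State i) j\<bar> + \<bar>g j\<bar>) * N t" if i: "i \<in> S" for i
      proof -
        have "X (Suc t) i = (\<Sum>j\<in>S. (W (State i) j + (if s = State i then g j else 0)) * X t j)"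
          unfolding dynS[OF i] u by (simp add: sum.distrib algebra_simps)
        also have "\<bar>\<dots>\<bar> \<le> (\<Sum>j\<in>S. \<bar>(W (State i) j + (if s = State i then g j else 0)) * X t j\<bar>)"
          by (rule sum_abs)
        also have "\<dots> \<le> (\<Sum>j\<in>S. (\<bar>W (State i) j\<bar> + \<bar>g j\<bar>) * N t)"
          by (intro sum_mono) (auto simp: abs_mult intro!: mult_mono Ni)
        finally show ?thesis by (simp only: sum_distrib_right)
      qed
      then have "N (Suc t) \<le> (\<Sum>i\<in>S. (\<Sum>j\<in>S. \<bar>W (State i) j\<bar> + \<bar>g j\<bar>) * N t)"
        by (subst N_def) (rule sum_mono)
      then show ?thesis by (simp only: C_def sum_distrib_right)
    qed
    have growr: "N (t + r) \<le> C ^ r * N t" for t r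
    proof (induction r)
      case (Suc r)
      have "N (t + Suc r) \<le> C * N (t + r)" using grow by simp
      also have "\<dots> \<le> C * (C ^ r * N t)" using Suc C by (intro mult_left_mono)
      finally show ?case by simp
    qed simp
    \<comment> \<open>Over \<open>k\<close> steps the norm is multiplied by exactly
      \<open>\<gamma> ^ k\<close>, while the closed loop allows at most
      \<open>C ^ k\<close>.\<close>
    have N: "N t = 0" for t
    proof -
      have "N (t + k) = \<gamma> ^ k * N t"
        using C by (simp add: N_def per abs_mult sum_distrib_left \<gamma>_def)
      then have "(\<gamma> ^ k - C ^ k) * N t \<le> 0" using growr[of t k] by (simp add: algebra_simps)
      moreover have "\<gamma> ^ k > C ^ k" unfolding \<gamma>_def using C k by (intro power_strict_mono) auto
      ultimately show ?thesis using N0[of t] by (auto simp: mult_le_0_iff intro: antisym)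
    qed
    have XS: "X t i = 0" if "i \<in> S" for t i using Ni[OF that, of t] N by simp
    have Xa: "X t a = 0" for t using u XS by simp
    have XK: "X t i = 0" if i: "i \<in> K" for t i
    proof -
      obtain r where "(p ^^ r) i = a" using orb i a by blast
      then have "\<gamma> ^ r * X t i = 0" using iter[OF i, of r t] Xa by simp
      then show ?thesis using C by (simp add: \<gamma>_def)
    qed
    show "\<forall>i\<in>S \<union> K. X t0 i = 0" using XS XK by blast
  qed
  moreover have "\<forall>v j. W' v j \<noteq> 0 \<longrightarrow> W v j \<noteq> 0 \<or> j \<in> K \<and> v = State (p j) \<or> v = s \<and> j = a"
    by (auto simp: W'_def)
  ultimately show ?thesis by blast
qed

section \<open>Stems and cycles of a predecessor map\<close>

locale predecessor_map =
  fixes V I :: "nat set" and f :: "nat \<Rightarrow> node"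
  assumes finite_V: "finite V"
    and inj_f: "inj_on f V"
    and f_mem: "j \<in> V \<Longrightarrow> f j \<in> State ` V \<union> Input ` I"
begin

text \<open>Following \<open>f\<close> backwards from a state either reaches an input node or never
  does. The states of the first kind lie on stems; since \<open>f\<close> is injective and
  \<open>V\<close> finite, the others split into cycles.\<close>

inductive_set rooted :: "nat set" where
  input: "j \<in> V \<Longrightarrow> f j = Input l \<Longrightarrow> j \<in> rooted"
| state: "j \<in> V \<Longrightarrow> f j = State i \<Longrightarrow> i \<in> rooted \<Longrightarrow> j \<in> rooted"

lemma rooted_subset: "rooted \<subseteq> V"
  by (auto elim: rooted.cases)

lemma finite_rooted: "finite rooted"
  using rooted_subset finite_V by (rule finite_subset)

text \<open>Extended by the identity, so that it is a permutation of all of \<open>nat\<close> and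
  its orbits inside \<open>V - rooted\<close> are the cycles of \<open>f\<close>.\<close>

definition prev_state :: "nat \<Rightarrow> nat" where
  "prev_state j = (if j \<in> V - rooted then THE i. f j = State i else j)"

lemma prev_state:
  assumes "j \<in> V - rooted"
  shows "f j = State (prev_state j)" and "prev_state j \<in> V - rooted"
proof -
  obtain i where i: "f j = State i" "i \<in> V"
    using f_mem[of j] assms rooted.input by (cases "f j") auto
  then have "i \<notin> rooted" using rooted.state assms by blast
  moreover have "prev_state j = i" using i assms by (simp add: prev_state_def)
  ultimately show "f j = State (prev_state j)" "prev_state j \<in> V - rooted" using i by auto
qed

lemma prev_state_permutes: "prev_state permutes (V - rooted)"
proof (rule bij_imp_permutes)
  have "inj_on prev_state (V - rooted)"
    using prev_state(1) inj_f unfolding inj_on_def by (metis DiffD1)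
  moreover have "prev_state ` (V - rooted) \<subseteq> V - rooted" using prev_state(2) by blast
  ultimately show "bij_betw prev_state (V - rooted) (V - rooted)"
    using endo_inj_surj finite_V by (metis bij_betw_def finite_Diff)
qed (auto simp: prev_state_def)

lemma permutation_prev_state: "permutation prev_state"
  using prev_state_permutes finite_V permutation_permutes by blast

lemma cyclic_on_prev_state: "cyclic_on prev_state (orbit prev_state a)"
  using permutation_prev_state by (rule cyclic_on_orbit')

lemma self_in_orbit_prev_state: "a \<in> orbit prev_state a"
  using permutation_prev_state by (rule permutation_self_in_orbit)

lemma orbit_prev_state_subset:
  assumes "a \<in> V - rooted"
  shows "orbit prev_state a \<subseteq> V - rooted"
  using prev_state_permutes assms by (rule permutes_orbit_subset)

text \<open>The first state of a stem is seen directly by its input node, and the value at a later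
  state is the value at its predecessor one time step later. Injectivity of \<open>f\<close> leaves
  a single term in each sum.\<close>

lemma controllable_on_rooted:
  "controllable_on rooted I (\<lambda>v j. if j \<in> rooted \<and> f j = v then 1 else 0)" (is "controllable_on _ _ ?W")
  unfolding controllable_on_def
proof (intro allI impI ballI)
  fix X and t i :: nat
  assume dyn: "\<forall>t. \<forall>i\<in>rooted. X (Suc t) i = (\<Sum>j\<in>rooted. ?W (State i) j * X t j)"
    and out: "\<forall>t. \<forall>l\<in>I. (\<Sum>j\<in>rooted. ?W (Input l) j * X t j) = (0::real)"
    and i: "i \<in> rooted"
  have sum: "(\<Sum>j\<in>rooted. ?W (f i) j * X t j) = X t i" if "i \<in> rooted" for i t
  proof -
    have "(\<Sum>j\<in>rooted. ?W (f i) j * X t j) = (\<Sum>j\<in>rooted. if j = i then X t i else 0)"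
      using that rooted_subset by (intro sum.cong) (auto dest: inj_onD[OF inj_f])
    then show ?thesis using that finite_rooted by simp
  qed
  from i show "X t i = 0"
  proof (induction arbitrary: t rule: rooted.induct)
    case (input j l)
    then have "l \<in> I" "j \<in> rooted" using f_mem[of j] rooted.input by auto
    then show ?case using out[rule_format, of l t] sum[of j t] input by simp
  next
    case (state j i)
    then have "j \<in> rooted" using rooted.state by auto
    then show ?case using dyn[rule_format, of i t] sum[of j t] state by simp
  qed
qed

lemma controllable_on_weights_exist:
  assumes edge: "\<And>j. j \<in> V \<Longrightarrow> E (f j) j"
    and access: "\<And>S. S \<subset> V \<Longrightarrow> \<exists>s \<in> State ` S \<union> Input ` I. \<exists>a \<in> V - S. E s a"
  shows "\<exists>W. (\<forall>v j. W v j \<noteq> 0 \<longrightarrow> E v j) \<and> controllable_on V I W"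
proof -
  \<comment> \<open>Closure of \<open>S\<close> under \<open>prev_state\<close> is the invariant
    that matters: it makes the cycle through a state outside \<open>S\<close> miss \<open>S\<close>
    entirely. The support condition keeps the weights on arcs into \<open>S\<close> from
    \<open>S\<close> or from input nodes, as attaching a cycle requires.\<close>
  have extend: "\<exists>W. (\<forall>v j. W v j \<noteq> 0 \<longrightarrow> E v j) \<and> controllable_on V I W"
    if "rooted \<subseteq> S" "S \<subseteq> V" "\<forall>j\<in>S. prev_state j \<in> S" "controllable_on S I W"
      "\<forall>v j. W v j \<noteq> 0 \<longrightarrow> E v j \<and> j \<in> S \<and> v \<in> State ` S \<union> Input ` I" for S W
    using that
  proof (induction "card (V - S)" arbitrary: S W rule: less_induct)
    case less
    show ?case
    proof (cases "S = V")
      case True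
      then show ?thesis using less.prems by blast
    next
      case False
      then obtain s a where s: "s \<in> State ` S \<union> Input ` I" and a: "a \<in> V - S" and sa: "E s a"
        using access[of S] less.prems(2) by blast
      define K where "K = orbit prev_state a"
      have cyc: "cyclic_on prev_state K" unfolding K_def by (rule cyclic_on_prev_state)
      have aK: "a \<in> K" unfolding K_def by (rule self_in_orbit_prev_state)
      have KV: "K \<subseteq> V - rooted"
        unfolding K_def using a less.prems by (intro orbit_prev_state_subset) auto
      have iter: "(prev_state ^^ r) j \<in> S" if "j \<in> S" for r j
        using that less.prems(3) by (induction r) auto
      have disj: "S \<inter> K = {}"
      proof (rule ccontr)
        assume "S \<inter> K \<noteq> {}"
        then obtain j where "j \<in> S" "j \<in> K" by blast
        then have "a \<in> orbit prev_state j" using orbit_cyclic_eq3[OF cyc] aK by simp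
        then show False using iter[OF \<open>j \<in> S\<close>] a by (auto simp: orbit_altdef)
      qed
      have "finite S" using less.prems(2) finite_V finite_subset by blast
      then obtain W' where W': "\<And>v j. W' v j \<noteq> 0 \<Longrightarrow> W v j \<noteq> 0 \<or> j \<in> K \<and> v = State (prev_state j) \<or> v = s \<and> j = a"
        and ctrb: "controllable_on (S \<union> K) I W'"
        using controllable_on_attach_cycle[OF _ less.prems(4) _ s cyc permutes_inj[OF prev_state_permutes] disj aK]
          less.prems(5) by metis
      show ?thesis
      proof (rule less.hyps[OF _ _ _ _ ctrb])
        have "V - (S \<union> K) \<subset> V - S" using aK a by blast
        then show "card (V - (S \<union> K)) < card (V - S)" using finite_V by (intro psubset_card_mono) auto
        show "rooted \<subseteq> S \<union> K" "S \<union> K \<subseteq> V" using less.prems KV by auto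
        show "\<forall>j\<in>S \<union> K. prev_state j \<in> S \<union> K"
          using less.prems(3) cyclic_on_inI[OF cyc] by blast
        have K_edge: "E (State (prev_state j)) j" "State (prev_state j) \<in> State ` K" if "j \<in> K" for j
          using edge[of j] prev_state(1)[of j] KV that cyclic_on_inI[OF cyc that] by auto
        show "\<forall>v j. W' v j \<noteq> 0 \<longrightarrow> E v j \<and> j \<in> S \<union> K \<and> v \<in> State ` (S \<union> K) \<union> Input ` I"
        proof (intro allI impI)
          fix v j assume "W' v j \<noteq> 0"
          then consider "W v j \<noteq> 0" | "j \<in> K" "v = State (prev_state j)" | "v = s" "j = a"
            using W' by blast
          then show "E v j \<and> j \<in> S \<union> K \<and> v \<in> State ` (S \<union> K) \<union> Input ` I"
          proof cases
            case 1
            then show ?thesis using less.prems(5) by (simp add: image_Un) blast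
          next
            case 2
            then show ?thesis using K_edge[of j] by auto
          next
            case 3
            then show ?thesis using s sa aK by auto
          qed
        qed
      qed
    qed
  qed
  show ?thesis
  proof (rule extend[OF order_refl rooted_subset _ controllable_on_rooted])
    show "\<forall>j\<in>rooted. prev_state j \<in> rooted" by (simp add: prev_state_def)
    show "\<forall>v j. (if j \<in> rooted \<and> f j = v then 1 else (0::real)) \<noteq> 0 \<longrightarrow>
        E v j \<and> j \<in> rooted \<and> v \<in> State ` rooted \<union> Input ` I"
    proof (intro allI impI)
      fix v j assume "(if j \<in> rooted \<and> f j = v then 1 else (0::real)) \<noteq> 0"
      then have j: "j \<in> rooted" "v = f j" by (auto split: if_splits)
      then have "v \<in> State ` rooted \<union> Input ` I"
        using f_mem[of j] by (auto elim!: rooted.cases[of j])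
      then show "E v j \<and> j \<in> rooted \<and> v \<in> State ` rooted \<union> Input ` I"
        using j edge rooted_subset by auto
    qed
  qed
qed

end

section \<open>Rank of the controllability matrix\<close>

text \<open>Padding the \<open>k\<close> equations with zero rows gives a square matrix, and its
  zero row \<open>k\<close> makes it singular.\<close>

lemma underdetermined_system_solution:
  fixes a :: "nat \<Rightarrow> nat \<Rightarrow> 'a :: field"
  assumes "k < n"
  shows "\<exists>c. (\<exists>j<n. c j \<noteq> 0) \<and> (\<forall>i<k. (\<Sum>j<n. a i j * c j) = 0)"
proof -
  define M where "M = mat n n (\<lambda>(i, j). if i < k then a i j else 0)"
  have M: "M \<in> carrier_mat n n" by (simp add: M_def)
  have "M\<^sup>T *\<^sub>v unit_vec n k = 0\<^sub>v n"
    using assms by (intro eq_vecI) (auto simp: M_def)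
  then have "det M\<^sup>T = 0"
    using M assms by (subst det_0_iff_vec_prod_zero_field[of _ n]) (auto intro!: exI[of _ "unit_vec n k"])
  then have "det M = 0" using det_transpose[OF M] by simp
  then obtain v where v: "v \<in> carrier_vec n" "v \<noteq> 0\<^sub>v n" "M *\<^sub>v v = 0\<^sub>v n"
    using det_0_iff_vec_prod_zero_field[OF M] by blast
  have "(\<Sum>j<n. a i j * v $ j) = 0" if "i < k" for i
  proof -
    have "(M *\<^sub>v v) $ i = 0" using v that assms by simp
    then show ?thesis
      using M that assms v(1) by (simp add: M_def scalar_prod_def lessThan_atLeast0)
  qed
  moreover have "\<exists>j<n. v $ j \<noteq> 0" using v(1,2) by (metis carrier_vecD eq_vecI index_zero_vec)
  ultimately show ?thesis by (intro exI[of _ "\<lambda>j. v $ j"]) auto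
qed

text \<open>Take a maximal independent set of columns. If it has \<open>n\<close> elements they form
  an invertible matrix, which leaves no nonzero orthogonal vector. If it has fewer, an
  underdetermined system has a nonzero solution, orthogonal to their span and hence to all
  columns.\<close>

lemma (in vec_space) rank_eq_dim_iff:
  assumes C: "C \<in> carrier_mat n nc"
  shows "rank C = n \<longleftrightarrow> (\<forall>v \<in> carrier_vec n. (\<forall>w \<in> set (cols C). v \<bullet> w = 0) \<longrightarrow> v = 0\<^sub>v n)"
proof -
  have colsC: "set (cols C) \<subseteq> carrier_vec n" using C cols_dim by blast
  obtain S where S: "maximal S (\<lambda>T. T \<subseteq> set (cols C) \<and> lin_indpt T)"
    using maximal_exists_superset[of "set (cols C)" "\<lambda>T. T \<subseteq> set (cols C) \<and> lin_indpt T" "{}"]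
      finite_lin_indpt2[of "{}"] by auto
  then have SC: "S \<subseteq> set (cols C)" and indpt: "lin_indpt S" by (auto simp: maximal_def)
  then have Sc: "S \<subseteq> carrier_vec n" and finS: "finite S" using colsC finite_subset by auto
  have rank: "rank C = card S" using rank_card_indpt[OF C S] .
  obtain ws where ws: "set ws = S" "distinct ws" using finite_distinct_list[OF finS] by blast
  have len: "length ws = card S" using ws distinct_card by metis
  have wi: "ws ! i \<in> carrier_vec n" if "i < length ws" for i using that ws Sc nth_mem by blast
  have le: "card S \<le> n" using li_le_dim(2)[OF fin_dim _ indpt] Sc dim_is_n by simp
  have span: "w \<in> span S" if w: "w \<in> set (cols C)" for w
  proof (cases "w \<in> S")
    case True
    then show ?thesis using Sc in_own_span by auto
  next
    case False
    then have "lin_dep (insert w S)" using S SC w unfolding maximal_def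
      by (metis insertI1 insert_subset subset_insertI)
    then show ?thesis using lin_dep_iff_in_span[OF _ indpt _ False] Sc w colsC by auto
  qed
  show ?thesis
  proof (intro iffI ballI impI)
    fix v assume full: "rank C = n" and v: "v \<in> carrier_vec n" and ortho: "\<forall>w \<in> set (cols C). v \<bullet> w = 0"
    define M where "M = mat_of_cols n ws"
    have lenn: "length ws = n" using full rank len by metis
    have M: "M \<in> carrier_mat n n" using mat_of_cols_carrier(1)[of n ws] by (simp only: M_def lenn)
    have "cols M = ws" unfolding M_def using ws Sc by (intro cols_mat_of_cols) auto
    then have "rank M = n" using lin_indpt_full_rank[OF M] ws indpt by simp
    then have "det M\<^sup>T \<noteq> 0" using det_rank_iff[OF M] det_transpose[OF M] by simp
    moreover have "M\<^sup>T *\<^sub>v v = 0\<^sub>v n"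
    proof (rule eq_vecI)
      fix i assume "i < dim_vec (0\<^sub>v n :: 'a vec)"
      then have i: "i < n" by simp
      then have "ws ! i \<in> set (cols C)" using lenn ws(1) SC nth_mem[of i ws] by auto
      then have "v \<bullet> ws ! i = 0" using ortho by blast
      then show "(M\<^sup>T *\<^sub>v v) $ i = 0\<^sub>v n $ i"
        using i v wi[of i] lenn by (simp add: M_def comm_scalar_prod[of v n])
    qed (use M in simp)
    ultimately show "v = 0\<^sub>v n"
      using det_0_iff_vec_prod_zero_field[of "M\<^sup>T" n] M v by auto
  next
    assume ker: "\<forall>v \<in> carrier_vec n. (\<forall>w \<in> set (cols C). v \<bullet> w = 0) \<longrightarrow> v = 0\<^sub>v n"
    show "rank C = n"
    proof (rule ccontr)
      assume "rank C \<noteq> n"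
      then have "length ws < n" using rank le len by (metis le_neq_implies_less)
      then obtain c where c: "\<exists>j<n. c j \<noteq> 0" "\<And>i. i < length ws \<Longrightarrow> (\<Sum>j<n. ws ! i $ j * c j) = 0"
        using underdetermined_system_solution[of "length ws" n "\<lambda>i j. ws ! i $ j"] by blast
      have "vec n c \<bullet> w = 0" if wC: "w \<in> set (cols C)" for w
      proof -
        have w: "w \<in> carrier_vec n" using wC colsC by blast
        obtain a T where T: "w = lincomb a T" "T \<subseteq> S" using in_spanE[OF span[OF wC]] by blast
        have "(\<Sum>j<n. x $ j * c j) = 0" if "x \<in> T" for x
          using that T ws c(2) by (metis in_set_conv_nth subsetD)
        then have zero: "(\<Sum>x\<in>T. a x * (\<Sum>j<n. x $ j * c j)) = 0" by simp
        have "vec n c \<bullet> w = (\<Sum>j<n. c j * w $ j)"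
          using w by (simp add: scalar_prod_def lessThan_atLeast0)
        also have "\<dots> = (\<Sum>j<n. \<Sum>x\<in>T. a x * (x $ j * c j))"
          using T Sc by (intro sum.cong) (auto simp: lincomb_index sum_distrib_left ac_simps)
        also have "\<dots> = (\<Sum>x\<in>T. a x * (\<Sum>j<n. x $ j * c j))"
          by (subst sum.swap) (simp add: sum_distrib_left)
        finally show ?thesis using zero by simp
      qed
      then have "vec n c = 0\<^sub>v n" using ker by auto
      then show False using c(1) by (metis index_vec index_zero_vec(1))
    qed
  qed
qed

section \<open>Transposed dynamics and the left kernel of the controllability matrix\<close>

text \<open>Iterating the transpose of \<open>A\<close> shows that the output at time
  \<open>t\<close> is the pairing of the initial state with the columns of the block
  \<open>A^t B\<close>. This translates between rank and silence.\<close>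

lemma left_trajectory:
  fixes A B :: "real mat"
  assumes A: "A \<in> carrier_mat n n" and B: "B \<in> carrier_mat n m"
    and y: "\<And>t i. i < n \<Longrightarrow> y (Suc t) i = (\<Sum>j<n. A $$ (j, i) * y t j)"
  shows "i < n \<Longrightarrow> y t i = (\<Sum>j<n. (A ^\<^sub>m t) $$ (j, i) * y 0 j)"
    and "l < m \<Longrightarrow> (\<Sum>i<n. B $$ (i, l) * y t i) = (\<Sum>j<n. (A ^\<^sub>m t * B) $$ (j, l) * y 0 j)"
proof -
  have entry: "(P * Q) $$ (j, l) = (\<Sum>i<n. P $$ (j, i) * Q $$ (i, l))"
    if "P \<in> carrier_mat n n" "Q \<in> carrier_mat n q" "j < n" "l < q" for P Q :: "real mat" and j l q
    using that by (auto simp: scalar_prod_def lessThan_atLeast0)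
  have pow: "A ^\<^sub>m t \<in> carrier_mat n n" for t using A by simp
  have exchange: "(\<Sum>i<n. Q $$ (i, l) * (\<Sum>j<n. P $$ (j, i) * x j)) = (\<Sum>j<n. (P * Q) $$ (j, l) * x j)"
    if "P \<in> carrier_mat n n" "Q \<in> carrier_mat n q" "l < q" for P Q :: "real mat" and l q x
  proof -
    have "(\<Sum>i<n. Q $$ (i, l) * (\<Sum>j<n. P $$ (j, i) * x j)) = (\<Sum>i<n. \<Sum>j<n. P $$ (j, i) * Q $$ (i, l) * x j)"
      by (simp add: sum_distrib_left ac_simps)
    also have "\<dots> = (\<Sum>j<n. \<Sum>i<n. P $$ (j, i) * Q $$ (i, l) * x j)" by (rule sum.swap)
    also have "\<dots> = (\<Sum>j<n. (P * Q) $$ (j, l) * x j)"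
      using that by (intro sum.cong) (auto simp: entry sum_distrib_right simp del: index_mult_mat)
    finally show ?thesis .
  qed
  show state: "y t i = (\<Sum>j<n. (A ^\<^sub>m t) $$ (j, i) * y 0 j)" if "i < n" for i t
    using that
  proof (induction t arbitrary: i)
    case 0
    have "(\<Sum>j<n. (A ^\<^sub>m 0) $$ (j, i) * y 0 j) = (\<Sum>j<n. if j = i then y 0 i else 0)"
      using A 0 by (intro sum.cong) auto
    then show ?case using 0 by simp
  next
    case (Suc t)
    have "y (Suc t) i = (\<Sum>k<n. A $$ (k, i) * (\<Sum>j<n. (A ^\<^sub>m t) $$ (j, k) * y 0 j))"
      using Suc y by simp
    then show ?case using exchange[OF pow A, of i t "y 0"] Suc by simp
  qed
  show "(\<Sum>i<n. B $$ (i, l) * y t i) = (\<Sum>j<n. (A ^\<^sub>m t * B) $$ (j, l) * y 0 j)" if "l < m"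
    using exchange[OF pow B that, of t "y 0"] by (simp add: state[where t = t])
qed

lemma block_index_less:
  fixes k l m n :: nat
  assumes "k < n" "l < m"
  shows "k * m + l < n * m"
proof -
  have "k * m + l < Suc k * m" using assms by simp
  also have "\<dots> \<le> n * m" using assms by (intro mult_le_mono1) simp
  finally show ?thesis .
qed

lemma full_row_rank_controllability_matrix_iff:
  fixes A B :: "real mat"
  assumes A: "A \<in> carrier_mat n n" and B: "B \<in> carrier_mat n m"
  shows "full_row_rank (controllability_matrix A B) \<longleftrightarrow>
    (\<forall>y. (\<forall>k<n. \<forall>l<m. (\<Sum>j<n. (A ^\<^sub>m k * B) $$ (j, l) * y j) = 0) \<longrightarrow> (\<forall>j<n. y j = 0))"
proof -
  interpret vec_space "TYPE(real)" n .
  define C where "C = controllability_matrix A B"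
  have C: "C \<in> carrier_mat n (n * m)"
    using B by (simp add: C_def controllability_matrix_def Let_def)
  have entry: "C $$ (j, k * m + l) = (A ^\<^sub>m k * B) $$ (j, l)" if "j < n" "k < n" "l < m" for j k l
  proof -
    have "k * m + l < n * m" using that by (intro block_index_less)
    then show ?thesis using that B unfolding C_def controllability_matrix_def Let_def by simp
  qed
  have prod: "v \<bullet> col C (k * m + l) = (\<Sum>j<n. (A ^\<^sub>m k * B) $$ (j, l) * v $ j)"
    if "v \<in> carrier_vec n" "k < n" "l < m" for v k l
  proof -
    have "k * m + l < n * m" using that by (intro block_index_less)
    then show ?thesis
      using that C entry by (simp add: scalar_prod_def lessThan_atLeast0 mult.commute)
  qed
  have cols: "(\<forall>w \<in> set (cols C). v \<bullet> w = 0) \<longleftrightarrow> (\<forall>k<n. \<forall>l<m. v \<bullet> col C (k * m + l) = 0)" for v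
  proof -
    have "set (cols C) = (\<lambda>c. col C c) ` {..<n * m}" using C by (auto simp: cols_def)
    moreover have "{..<n * m} = (\<lambda>(k, l). k * m + l) ` ({..<n} \<times> {..<m})"
    proof (intro equalityI subsetI)
      fix c assume "c \<in> {..<n * m}"
      then have c: "c < n * m" by simp
      then have "m > 0" by (cases m) auto
      then have "c div m < n" "c mod m < m" using c by (auto simp: less_mult_imp_div_less)
      then show "c \<in> (\<lambda>(k, l). k * m + l) ` ({..<n} \<times> {..<m})"
        by (intro image_eqI[of _ _ "(c div m, c mod m)"]) auto
    next
      fix c assume "c \<in> (\<lambda>(k, l). k * m + l) ` ({..<n} \<times> {..<m})"
      then show "c \<in> {..<n * m}" by (auto intro: block_index_less)
    qed
    ultimately show ?thesis by auto
  qed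
  have "full_row_rank C \<longleftrightarrow> rank C = n" using C by (simp add: full_row_rank_def)
  also have "\<dots> \<longleftrightarrow> (\<forall>v \<in> carrier_vec n. (\<forall>k<n. \<forall>l<m. (\<Sum>j<n. (A ^\<^sub>m k * B) $$ (j, l) * v $ j) = 0) \<longrightarrow> v = 0\<^sub>v n)"
    unfolding rank_eq_dim_iff[OF C] cols using prod by auto
  also have "\<dots> \<longleftrightarrow> (\<forall>y. (\<forall>k<n. \<forall>l<m. (\<Sum>j<n. (A ^\<^sub>m k * B) $$ (j, l) * y j) = 0) \<longrightarrow> (\<forall>j<n. y j = 0))"
    (is "?L \<longleftrightarrow> ?R")
  proof
    assume L: ?L
    show ?R
    proof (intro allI impI)
      fix y and j assume "\<forall>k<n. \<forall>l<m. (\<Sum>j<n. (A ^\<^sub>m k * B) $$ (j, l) * y j) = 0" and j: "j < n"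
      then have "vec n y = 0\<^sub>v n" using L by auto
      then show "y j = 0" using j by (metis index_vec index_zero_vec(1))
    qed
  next
    assume R: ?R
    show ?L
    proof (intro ballI impI)
      fix v :: "real vec" assume v: "v \<in> carrier_vec n"
        and "\<forall>k<n. \<forall>l<m. (\<Sum>j<n. (A ^\<^sub>m k * B) $$ (j, l) * v $ j) = 0"
      then have "\<forall>j<n. v $ j = 0" using R[rule_format, of "\<lambda>j. v $ j"] by blast
      then show "v = 0\<^sub>v n" using v by auto
    qed
  qed
  finally show ?thesis by (simp add: C_def)
qed

text \<open>The \<open>n + 1\<close> vectors \<open>y 0, \<dots>, y n\<close> are linearly dependent, so some \<open>y r\<close> with \<open>r \<le> n\<close> is a
  combination of its predecessors, and this relation propagates in time.\<close>
lemma silent_beyond_dimension: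
  fixes y :: "nat \<Rightarrow> nat \<Rightarrow> real"
  assumes y: "\<And>t i. i < n \<Longrightarrow> y (Suc t) i = (\<Sum>j<n. a j i * y t j)"
    and out: "\<And>t. t < n \<Longrightarrow> (\<Sum>j<n. b j * y t j) = 0"
  shows "(\<Sum>j<n. b j * y t j) = 0"
proof -
  obtain c where c: "\<exists>k<Suc n. c k \<noteq> 0" "\<And>i. i < n \<Longrightarrow> (\<Sum>k<Suc n. y k i * c k) = 0"
    using underdetermined_system_solution[of n "Suc n" "\<lambda>i k. y k i"] by auto
  \<comment> \<open>The last nonzero coefficient, so that the relation can be solved for its latest
    vector.\<close>
  define r where "r = Max {k. k < Suc n \<and> c k \<noteq> 0}"
  have "r \<in> {k. k < Suc n \<and> c k \<noteq> 0}" unfolding r_def using c(1) by (intro Max_in) auto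
  then have r: "r < Suc n" "c r \<noteq> 0" by auto
  have after: "c k = 0" if "k < Suc n" "r < k" for k
    using that Max_ge[of "{k. k < Suc n \<and> c k \<noteq> 0}" k] unfolding r_def by fastforce
  have rel: "(\<Sum>k<Suc r. c k * y (k + s) i) = 0" if "i < n" for s i
    using that
  proof (induction s arbitrary: i)
    case 0
    have "(\<Sum>k<Suc r. c k * y k i) = (\<Sum>k<Suc n. c k * y k i)"
      using r after by (intro sum.mono_neutral_left) auto
    then show ?case using c(2)[OF 0] by (simp add: mult.commute)
  next
    case (Suc s)
    have "(\<Sum>k<Suc r. c k * y (k + Suc s) i) = (\<Sum>k<Suc r. \<Sum>j<n. a j i * (c k * y (k + s) j))"
      using y[OF Suc.prems] by (simp add: sum_distrib_left ac_simps)
    also have "\<dots> = (\<Sum>j<n. a j i * (\<Sum>k<Suc r. c k * y (k + s) j))"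
      by (subst sum.swap) (simp only: sum_distrib_left)
    also have "\<dots> = 0" using Suc.IH by simp
    finally show ?case .
  qed
  show ?thesis
  proof (induction t rule: less_induct)
    case (less t)
    show ?case
    proof (cases "t < n")
      case False
      \<comment> \<open>Such an \<open>s\<close> exists because \<open>r \<le> n \<le> t\<close>. In
        the relation shifted by \<open>s\<close> all terms before the last vanish by
        induction.\<close>
      then obtain s where s: "t = r + s" using r by (metis le_Suc_ex less_Suc_eq_le not_le order_trans)
      have "(\<Sum>k<Suc r. c k * (\<Sum>j<n. b j * y (k + s) j)) = (\<Sum>j<n. b j * (\<Sum>k<Suc r. c k * y (k + s) j))"
        by (simp only: sum_distrib_left) (subst sum.swap, simp only: ac_simps)
      also have "\<dots> = 0" using rel by simp
      finally have "c r * (\<Sum>j<n. b j * y t j) = 0" using less s by simp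
      then show ?thesis using r by simp
    qed (rule out)
  qed
qed

text \<open>The matrix tests only the times below \<open>n\<close>, while the dual notion asks for
  silence at all times; \<open>silent_beyond_dimension\<close> closes this gap for the trajectory
  started at a left kernel vector.\<close>

lemma controllable_on_imp_full_row_rank:
  assumes "controllable_on {..<n} {..<m} W"
  shows "full_row_rank (controllability_matrix (mat n n (\<lambda>(j, i). W (State i) j)) (mat n m (\<lambda>(j, l). W (Input l) j)))"
    (is "full_row_rank (controllability_matrix ?A ?B)")
proof -
  have A: "?A \<in> carrier_mat n n" and B: "?B \<in> carrier_mat n m" by auto
  show ?thesis
    unfolding full_row_rank_controllability_matrix_iff[OF A B]
  proof (intro allI impI)
    fix x :: "nat \<Rightarrow> real" and i
    assume x: "\<forall>k<n. \<forall>l<m. (\<Sum>j<n. (?A ^\<^sub>m k * ?B) $$ (j, l) * x j) = 0" and i: "i < n"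
    define y where "y = (\<lambda>t. ((\<lambda>x i. \<Sum>j<n. W (State i) j * x j) ^^ t) x)"
    have y0: "y 0 = x" by (simp add: y_def)
    have y: "y (Suc t) i = (\<Sum>j<n. W (State i) j * y t j)" for t i by (simp add: y_def)
    have yA: "y (Suc t) i = (\<Sum>j<n. ?A $$ (j, i) * y t j)" if "i < n" for t i
      using that by (simp add: y)
    have out: "(\<Sum>j<n. W (Input l) j * y t j) = 0" if l: "l < m" for t l
    proof (rule silent_beyond_dimension[where y = y and a = "\<lambda>j i. W (State i) j", OF y])
      fix t assume "t < n"
      then have "(\<Sum>j<n. ?B $$ (j, l) * y t j) = 0"
        using left_trajectory(2)[where y = y, OF A B yA l] x l by (simp add: y0)
      then show "(\<Sum>j<n. W (Input l) j * y t j) = 0" using l by simp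
    qed
    have "y 0 i = 0"
      using assms y out i by (intro controllable_onD[OF assms, of y]) auto
    then show "x i = 0" by (simp add: y0)
  qed
qed

text \<open>The trajectory that is \<open>x\<close> at time 0 and zero afterwards obeys the
  transposed dynamics and is silent, so \<open>x\<close> is orthogonal to every block.\<close>

lemma full_row_rank_left_kernel:
  fixes A B :: "real mat"
  assumes A: "A \<in> carrier_mat n n" and B: "B \<in> carrier_mat n m"
    and rank: "full_row_rank (controllability_matrix A B)"
    and kerA: "\<And>i. i < n \<Longrightarrow> (\<Sum>j<n. A $$ (j, i) * x j) = 0"
    and kerB: "\<And>l. l < m \<Longrightarrow> (\<Sum>j<n. B $$ (j, l) * x j) = 0"
    and j: "j < n"
  shows "x j = 0"
proof -
  define y where "y = (\<lambda>(t::nat) i. if t = 0 then x i else (0::real))"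
  have y: "y (Suc t) i = (\<Sum>j<n. A $$ (j, i) * y t j)" if "i < n" for t i
    using kerA[OF that] by (cases t) (simp_all add: y_def)
  have "(\<Sum>i<n. (A ^\<^sub>m k * B) $$ (i, l) * x i) = 0" if "l < m" for k l
  proof -
    have "(\<Sum>i<n. (A ^\<^sub>m k * B) $$ (i, l) * y 0 i) = (\<Sum>i<n. B $$ (i, l) * y k i)"
      using left_trajectory(2)[where y = y, OF A B y that] by simp
    also have "\<dots> = 0" using kerB[OF that] by (cases k) (simp_all add: y_def)
    finally show ?thesis by (simp add: y_def)
  qed
  then show ?thesis using rank[unfolded full_row_rank_controllability_matrix_iff[OF A B]] j by blast
qed

text \<open>Take a row \<open>i0\<close>. If deleting each column \<open>c\<close> of its support made the remaining rows dependent,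
  all unit vectors \<open>c\<close> of the support, hence row \<open>i0\<close> itself, would be spanned by the remaining rows.\<close>
lemma independent_rows_transversal:
  fixes M :: "'a \<Rightarrow> 'b \<Rightarrow> 'c :: field"
  assumes "finite R" "finite C"
    and "\<And>x. (\<And>c. c \<in> C \<Longrightarrow> (\<Sum>i\<in>R. x i * M i c) = 0) \<Longrightarrow> (\<And>i. i \<in> R \<Longrightarrow> x i = 0)"
  shows "\<exists>f. inj_on f R \<and> (\<forall>i\<in>R. f i \<in> C \<and> M i (f i) \<noteq> 0)"
  using assms
proof (induction R arbitrary: C rule: finite_induct)
  case (insert i0 R)
  have split: "(\<Sum>i\<in>insert i0 R. x i * M i c) = x i0 * M i0 c + (\<Sum>i\<in>R. x i * M i c)" for x c
    using insert.hyps by simp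
  \<comment> \<open>Column \<open>c\<close> will be reserved for row \<open>i0\<close>; the
    induction hypothesis needs the remaining rows to stay independent without it.\<close>
  have "\<exists>c\<in>C. M i0 c \<noteq> 0 \<and> (\<forall>x. (\<forall>d\<in>C - {c}. (\<Sum>i\<in>R. x i * M i d) = 0) \<longrightarrow> (\<forall>i\<in>R. x i = 0))"
  proof (rule ccontr)
    assume neg: "\<not> ?thesis"
    have "\<exists>x. (\<forall>d\<in>C. (\<Sum>i\<in>R. x i * M i d) = (if d = c then 1 else 0))" if c: "c \<in> C" "M i0 c \<noteq> 0" for c
    proof -
      obtain x i where x: "\<forall>d\<in>C - {c}. (\<Sum>i\<in>R. x i * M i d) = 0" and i: "i \<in> R" "x i \<noteq> 0"
        using neg c by blast
      define al where "al = (\<Sum>i\<in>R. x i * M i c)"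
      have "al \<noteq> 0"
      proof
        assume "al = 0"
        \<comment> \<open>The value \<open>x i0\<close> is arbitrary and must be reset to 0 before
          \<open>x\<close> becomes a relation among all rows.\<close>
        define x' where "x' = x(i0 := 0)"
        have x': "(\<Sum>i\<in>R. x' i * M i d) = (\<Sum>i\<in>R. x i * M i d)" for d
          using insert.hyps by (intro sum.cong) (auto simp: x'_def)
        have "(\<Sum>i\<in>insert i0 R. x' i * M i d) = 0" if "d \<in> C" for d
          unfolding split x' using x \<open>al = 0\<close> that by (cases "d = c") (auto simp: al_def x'_def)
        then have "x' i = 0" using insert.prems(2)[of x'] i by blast
        then show False using i insert.hyps by (auto simp: x'_def split: if_splits)
      qed
      have "(\<Sum>i\<in>R. x i / al * M i d) = (if d = c then 1 else 0)" if "d \<in> C" for d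
      proof -
        have "(\<Sum>i\<in>R. x i / al * M i d) = (\<Sum>i\<in>R. x i * M i d) / al"
          by (simp add: sum_divide_distrib)
        then show ?thesis using x that \<open>al \<noteq> 0\<close> by (auto simp: al_def)
      qed
      then show ?thesis by (intro exI[of _ "\<lambda>i. x i / al"] ballI)
    qed
    then obtain z where z: "\<And>c d. c \<in> C \<Longrightarrow> M i0 c \<noteq> 0 \<Longrightarrow> d \<in> C \<Longrightarrow> (\<Sum>i\<in>R. z c i * M i d) = (if d = c then 1 else 0)"
      by metis
    \<comment> \<open>Row \<open>i0\<close> minus its own expansion in unit vectors, each replaced
      by the combination \<open>z c\<close> of the other rows: a relation with coefficient 1 at
      \<open>i0\<close>.\<close>
    define x where "x = (\<lambda>i. if i = i0 then 1 else - (\<Sum>c | c \<in> C \<and> M i0 c \<noteq> 0. M i0 c * z c i))"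
    have "(\<Sum>i\<in>insert i0 R. x i * M i d) = 0" if d: "d \<in> C" for d
    proof -
      have "(\<Sum>i\<in>R. x i * M i d) = (\<Sum>i\<in>R. \<Sum>c | c \<in> C \<and> M i0 c \<noteq> 0. - (M i0 c * (z c i * M i d)))"
        using insert.hyps by (intro sum.cong) (auto simp: x_def sum_distrib_right sum_negf mult.assoc)
      also have "\<dots> = (\<Sum>c | c \<in> C \<and> M i0 c \<noteq> 0. - M i0 c * (\<Sum>i\<in>R. z c i * M i d))"
        by (subst sum.swap) (simp add: sum_distrib_left)
      also have "\<dots> = (\<Sum>c | c \<in> C \<and> M i0 c \<noteq> 0. if c = d then - M i0 d else 0)"
        using d by (intro sum.cong) (auto simp: z)
      also have "\<dots> = - M i0 d" using insert.prems(1) d by simp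
      finally show ?thesis unfolding split by (simp add: x_def)
    qed
    then have "x i0 = 0" using insert.prems(2)[of x] by blast
    then show False by (simp add: x_def)
  qed
  then obtain c where c: "c \<in> C" "M i0 c \<noteq> 0"
    and indep: "\<And>x. (\<forall>d\<in>C - {c}. (\<Sum>i\<in>R. x i * M i d) = 0) \<Longrightarrow> (\<forall>i\<in>R. x i = 0)" by blast
  obtain f where f: "inj_on f R" "\<And>i. i \<in> R \<Longrightarrow> f i \<in> C - {c} \<and> M i (f i) \<noteq> 0"
    using insert.IH[of "C - {c}"] insert.prems(1) indep by blast
  have "inj_on (f(i0 := c)) (insert i0 R)"
    using f insert.hyps by (auto simp: inj_on_def)
  moreover have "\<forall>i\<in>insert i0 R. (f(i0 := c)) i \<in> C \<and> M i ((f(i0 := c)) i) \<noteq> 0"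
    using f c by auto
  ultimately show ?case by blast
qed auto

section \<open>Disjoint covers and predecessor maps\<close>

lemma set_vwalk_arcs: "set (vwalk_arcs p) = {(p ! i, p ! Suc i) | i. Suc i < length p}"
proof (induction p rule: vwalk_arcs.induct)
  case (3 x y xs)
  have "{((x # y # xs) ! i, (x # y # xs) ! Suc i) | i. Suc i < length (x # y # xs)}
      = insert (x, y) {((y # xs) ! i, (y # xs) ! Suc i) | i. Suc i < length (y # xs)}" (is "?L = ?R")
  proof (intro equalityI subsetI)
    fix e assume "e \<in> ?L"
    then obtain i where "Suc i < length (x # y # xs)" "e = ((x # y # xs) ! i, (x # y # xs) ! Suc i)"
      by blast
    then show "e \<in> ?R" by (cases i) auto
  next
    fix e assume "e \<in> ?R"
    then consider "e = (x, y)" | i where "Suc i < length (y # xs)" "e = ((y # xs) ! i, (y # xs) ! Suc i)"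
      by blast
    then show "e \<in> ?L"
    proof cases
      case 1
      then show ?thesis by (auto intro!: exI[of _ 0])
    next
      case (2 i)
      then show ?thesis by (auto intro!: exI[of _ "Suc i"])
    qed
  qed
  then show ?case using 3 by simp
qed auto

lemma vwalk_with_proj_iff:
  "vwalk p (with_proj G) \<longleftrightarrow>
     p \<noteq> [] \<and> set p \<subseteq> pverts G \<and> (\<forall>i. Suc i < length p \<longrightarrow> (p ! i, p ! Suc i) \<in> parcs G)"
  unfolding vwalk_def with_proj_simps set_vwalk_arcs by blast

text \<open>Since the nodes of a stem are distinct, no list is both a stem and a cycle. This sorts
  the members of a mixed family.\<close>

lemma graph_cycle_not_distinct:
  assumes "graph_cycle A B c"
  shows "\<not> distinct c"
proof
  assume "distinct c"
  moreover have "c ! 0 = c ! (length c - 1)" "length c \<ge> 2"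
    using assms by (auto simp: graph_cycle_def hd_conv_nth last_conv_nth)
  ultimately show False using nth_eq_iff_index_eq[of c 0 "length c - 1"] by (cases c) auto
qed

lemma stem_distinct: "stem A B p \<Longrightarrow> distinct p"
  by (auto simp: stem_def)

lemma graph_cycle_nth:
  assumes "graph_cycle A B c" "i < length (butlast c)"
  shows "c ! i = butlast c ! i" "c ! Suc i = butlast c ! (Suc i mod length (butlast c))"
proof -
  show "c ! i = butlast c ! i" using assms(2) by (simp add: nth_butlast)
  have c: "length c \<ge> 2" "hd c = last c" using assms by (auto simp: graph_cycle_def)
  show "c ! Suc i = butlast c ! (Suc i mod length (butlast c))"
  proof (cases "Suc i < length (butlast c)")
    case True
    then show ?thesis by (simp add: nth_butlast)
  next
    case False
    then have "Suc i = length c - 1" using assms(2) by simp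
    moreover have "c \<noteq> []" using c by auto
    ultimately show ?thesis using c assms(2) by (simp add: nth_butlast hd_conv_nth last_conv_nth)
  qed
qed

lemma disjoint_cover_imp_transversal:
  assumes mem: "\<And>p. p \<in> F \<Longrightarrow> stem A B p \<or> graph_cycle A B p" and cov: "covers F (state_nodes A)"
    and stem_cycle: "\<And>p c. p \<in> F \<Longrightarrow> c \<in> F \<Longrightarrow> stem A B p \<Longrightarrow> graph_cycle A B c \<Longrightarrow> set p \<inter> set c = {}"
    and cycles: "\<And>c d. c \<in> F \<Longrightarrow> d \<in> F \<Longrightarrow> graph_cycle A B c \<Longrightarrow> graph_cycle A B d \<Longrightarrow>
      set c \<inter> set d \<noteq> {} \<Longrightarrow> same_cycle c d"
    and stems: "\<And>p q. p \<in> F \<Longrightarrow> q \<in> F \<Longrightarrow> stem A B p \<Longrightarrow> stem A B q \<Longrightarrow>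
      set p \<inter> set q \<noteq> {} \<Longrightarrow> p = q"
  shows "\<exists>f. inj_on f {..<dim_row A} \<and> (\<forall>j<dim_row A. (f j, State j) \<in> parcs (system_graph A B))"
proof -
  let ?G = "system_graph A B"
  define R where "R = (\<lambda>v w. \<exists>p\<in>F. \<exists>i. Suc i < length p \<and> p ! i = v \<and> p ! Suc i = w)"
  have walk: "vwalk p ?G" if "p \<in> F" for p
    using mem[OF that] by (auto simp: stem_def graph_cycle_def)
  have arc: "(v, w) \<in> parcs ?G" if "R v w" for v w
    using that walk unfolding R_def vwalk_with_proj_iff by blast
  have pred: "\<exists>v. R v (State j)" if j: "j < dim_row A" for j
  proof -
    obtain p where p: "p \<in> F" "State j \<in> set p"
      using cov j by (auto simp: covers_def state_nodes_def)
    have "\<exists>i. Suc i < length p \<and> p ! Suc i = State j"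
      using mem[OF p(1)]
    proof
      assume st: "stem A B p"
      obtain k where k: "k < length p" "p ! k = State j" using p(2) by (auto simp: in_set_conv_nth)
      have "k \<noteq> 0"
      proof
        assume "k = 0"
        then have "hd p = State j" using k by (cases p) auto
        then show False using st by (auto simp: stem_def input_nodes_def)
      qed
      then show ?thesis using k by (cases k) auto
    next
      assume cyc: "graph_cycle A B p"
      obtain k where k: "k < length p" "p ! k = State j" using p(2) by (auto simp: in_set_conv_nth)
      show ?thesis
      proof (cases k)
        case 0
        \<comment> \<open>The starting node is written again at the end, so its predecessor stands
          at index \<open>length p - 2\<close>.\<close>
        have "length p \<ge> 2" "hd p = last p" using cyc by (auto simp: graph_cycle_def)
        then show ?thesis using k 0
          by (intro exI[of _ "length p - 2"]) (auto simp: hd_conv_nth last_conv_nth Suc_diff_Suc numeral_2_eq_2)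
      next
        case (Suc i)
        then show ?thesis using k by auto
      qed
    qed
    then show ?thesis using p(1) unfolding R_def by blast
  qed
  \<comment> \<open>A single successor for each node, across the whole family, is what makes the
    choice of predecessors injective.\<close>
  have uniq: "w = w'" if vw: "R v w" "R v w'" for v w w'
  proof -
    obtain p i where p: "p \<in> F" "Suc i < length p" "p ! i = v" "p ! Suc i = w"
      using vw(1) unfolding R_def by blast
    obtain q k where q: "q \<in> F" "Suc k < length q" "q ! k = v" "q ! Suc k = w'"
      using vw(2) unfolding R_def by blast
    have "v \<in> set p" "v \<in> set q" using p q nth_mem[of i p] nth_mem[of k q] by auto
    then have meet: "set p \<inter> set q \<noteq> {}" by blast
    show ?thesis
    proof (cases "stem A B p")
      case True
      then have "stem A B q" using stem_cycle[of p q] mem[OF q(1)] p(1) q(1) meet by blast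
      then have "p = q" using stems[OF p(1) q(1) True _ meet] by blast
      then have "i = k" using p q stem_distinct[OF True] nth_eq_iff_index_eq[of p i k] by simp
      then show ?thesis using p q \<open>p = q\<close> by simp
    next
      case False
      then have cp: "graph_cycle A B p" using mem[OF p(1)] by blast
      then have cq: "graph_cycle A B q" using stem_cycle[of q p] mem[OF q(1)] p(1) q(1) meet by blast
      \<comment> \<open>The family may contain several rotations of one cycle. Positions in
        \<open>q\<close> become positions in \<open>p\<close> by a shift modulo \<open>L\<close>,
        which commutes with passing to the next node.\<close>
      obtain r where r: "butlast q = rotate r (butlast p)"
        using cycles[OF p(1) q(1) cp cq meet] unfolding same_cycle_def by blast
      define L where "L = length (butlast p)"
      have Lq: "length (butlast q) = L" using r by (simp add: L_def)
      have iL: "i < L" and kL: "k < L" using p q Lq by (auto simp: L_def)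
      have "butlast p ! i = butlast p ! ((r + k) mod L)"
        using graph_cycle_nth(1)[OF cp, of i] graph_cycle_nth(1)[OF cq, of k] p q iL kL Lq
        by (simp add: L_def r nth_rotate)
      moreover have "(r + k) mod L < L" using iL by simp
      moreover have "distinct (butlast p)" using cp by (simp add: graph_cycle_def)
      ultimately have ik: "i = (r + k) mod L" using iL by (simp add: L_def nth_eq_iff_index_eq)
      have "w' = butlast q ! (Suc k mod L)"
        using graph_cycle_nth(2)[OF cq, of k] q kL Lq by simp
      also have "\<dots> = butlast p ! ((r + Suc k mod L) mod L)"
        using iL unfolding r by (subst nth_rotate) (auto simp: L_def)
      also have "(r + Suc k mod L) mod L = Suc i mod L"
        unfolding ik by (simp add: mod_simps)
      also have "butlast p ! (Suc i mod L) = w"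
        using graph_cycle_nth(2)[OF cp, of i] p iL by (simp add: L_def)
      finally show ?thesis by simp
    qed
  qed
  define f where "f = (\<lambda>j. SOME v. R v (State j))"
  have f: "R (f j) (State j)" if "j < dim_row A" for j
    unfolding f_def using pred[OF that] by (rule someI_ex)
  have "inj_on f {..<dim_row A}"
    using uniq f by (intro inj_onI) (metis lessThan_iff node.inject(1))
  then show ?thesis using f arc by blast
qed

section \<open>Explicit stems and cycles of a predecessor map\<close>

context predecessor_map
begin

definition next_node :: "node \<Rightarrow> node" where
  "next_node v = State (inv_into V f v)"

lemma next_node_eq:
  assumes "v \<in> f ` V"
  shows "\<exists>j\<in>V. next_node v = State j \<and> f j = v"
  using assms by (auto simp: next_node_def f_inv_into_f inv_into_into)

lemma next_node_f:
  assumes "j \<in> V"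
  shows "next_node (f j) = State j"
  using assms inj_f by (simp add: next_node_def)

text \<open>A node in the image of \<open>V\<close> under \<open>f\<close> is determined by its
  successor, and a positive iterate is a state, never an input node. Both chains can therefore be
  peeled from the end until they reach their inputs together.\<close>

lemma next_node_funpow_unique:
  assumes "\<forall>i<a. (next_node ^^ i) (Input l) \<in> f ` V" "\<forall>i<b. (next_node ^^ i) (Input l') \<in> f ` V"
    and "(next_node ^^ a) (Input l) = (next_node ^^ b) (Input l')"
  shows "a = b \<and> l = l'"
  using assms
proof (induction a arbitrary: b)
  case 0
  then show ?case by (cases b) (auto simp: next_node_def)
next
  case (Suc a)
  show ?case
  proof (cases b)
    case 0
    then show ?thesis using Suc.prems by (simp add: next_node_def)
  next
    case (Suc b')
    have "(next_node ^^ a) (Input l) \<in> f ` V" "(next_node ^^ b') (Input l') \<in> f ` V"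
      using Suc.prems Suc by auto
    moreover have "next_node ((next_node ^^ a) (Input l)) = next_node ((next_node ^^ b') (Input l'))"
      using Suc.prems(3) Suc by simp
    ultimately have "(next_node ^^ a) (Input l) = (next_node ^^ b') (Input l')"
      by (metis next_node_eq node.inject(1))
    then show ?thesis using Suc.IH[of b'] Suc.prems Suc by simp
  qed
qed

definition stem_end :: "nat \<Rightarrow> nat" where
  "stem_end l = (LEAST N. (next_node ^^ N) (Input l) \<notin> f ` V)"

definition stem_of :: "nat \<Rightarrow> node list" where
  "stem_of l = map (\<lambda>i. (next_node ^^ i) (Input l)) [0..<Suc (stem_end l)]"

text \<open>A chain that never left the image of \<open>f\<close> would visit infinitely many
  distinct nodes of a finite set.\<close>

lemma stem_end: "(next_node ^^ stem_end l) (Input l) \<notin> f ` V"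
proof -
  have "\<exists>N. (next_node ^^ N) (Input l) \<notin> f ` V"
  proof (rule ccontr)
    assume "\<not> ?thesis"
    then have all: "(next_node ^^ i) (Input l) \<in> f ` V" for i by blast
    then have "inj (\<lambda>i. (next_node ^^ i) (Input l))"
      using next_node_funpow_unique by (intro injI) blast
    moreover have "finite (range (\<lambda>i. (next_node ^^ i) (Input l)))"
      using all finite_V by (meson finite_imageI finite_subset image_subsetI)
    ultimately show False using range_inj_infinite by blast
  qed
  then show ?thesis unfolding stem_end_def by (rule LeastI_ex)
qed

lemma before_stem_end: "i < stem_end l \<Longrightarrow> (next_node ^^ i) (Input l) \<in> f ` V"
  unfolding stem_end_def using not_less_Least by blast

lemma length_stem_of: "length (stem_of l) = Suc (stem_end l)"
  by (simp add: stem_of_def)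

lemma nth_stem_of: "i \<le> stem_end l \<Longrightarrow> stem_of l ! i = (next_node ^^ i) (Input l)"
  by (simp add: stem_of_def del: upt_Suc)

lemma stem_of_unique:
  assumes "i \<le> stem_end l" "i' \<le> stem_end l'" "stem_of l ! i = stem_of l' ! i'"
  shows "i = i' \<and> l = l'"
  using assms before_stem_end by (intro next_node_funpow_unique) (auto simp: nth_stem_of)

lemma distinct_stem_of: "distinct (stem_of l)"
  unfolding distinct_conv_nth using stem_of_unique by (auto simp: length_stem_of less_Suc_eq_le)

lemma hd_stem_of: "hd (stem_of l) = Input l"
  using length_stem_of[of l] nth_stem_of[of 0 l] by (cases "stem_of l") auto

lemma stem_of_step:
  assumes "Suc i < length (stem_of l)"
  shows "\<exists>j\<in>V. stem_of l ! Suc i = State j \<and> f j = stem_of l ! i"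
  using assms next_node_eq[OF before_stem_end[of i l]] by (simp add: length_stem_of nth_stem_of)

lemma stem_of_disjoint:
  assumes "w \<in> set (stem_of l)" "w \<in> set (stem_of l')"
  shows "l = l'"
  using assms stem_of_unique by (metis in_set_conv_nth length_stem_of less_Suc_eq_le)

lemma stem_of_rooted:
  assumes "w \<in> set (stem_of l)"
  shows "w = Input l \<or> w \<in> State ` rooted"
proof -
  obtain i where "i < length (stem_of l)" "w = stem_of l ! i"
    using assms by (auto simp: in_set_conv_nth)
  then show ?thesis
  proof (induction i arbitrary: w)
    case 0
    then show ?case by (simp add: nth_stem_of)
  next
    case (Suc i)
    then obtain j where j: "j \<in> V" "w = State j" "f j = stem_of l ! i" using stem_of_step by blast
    have "stem_of l ! i = Input l \<or> stem_of l ! i \<in> State ` rooted" using Suc by simp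
    then have "j \<in> rooted" using j rooted.intros by auto
    then show ?case using j by blast
  qed
qed

lemma rooted_in_stem_of:
  assumes "j \<in> rooted"
  shows "\<exists>l\<in>I. Input l \<in> f ` V \<and> State j \<in> set (stem_of l)"
proof -
  \<comment> \<open>The bound on \<open>i\<close> is strict, so that the node following
    \<open>f j\<close>, namely \<open>State j\<close>, still lies on the stem.\<close>
  have "\<exists>l\<in>I. Input l \<in> f ` V \<and> (\<exists>i<stem_end l. f j = stem_of l ! i)"
    using assms
  proof (induction rule: rooted.induct)
    case (input j l)
    have lV: "Input l \<in> f ` V" using input by (metis imageI)
    then have "stem_end l \<noteq> 0" using stem_end[of l] by (metis funpow_0)
    moreover have "l \<in> I" using f_mem[of j] input by auto
    ultimately show ?case using input lV nth_stem_of[of 0 l] by (metis bot_nat_0.not_eq_extremum funpow_0 le0)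
  next
    case (state j i)
    then obtain l k where l: "l \<in> I" "Input l \<in> f ` V" "k < stem_end l" "f i = stem_of l ! k" by blast
    have "i \<in> V" using state rooted_subset by blast
    then have eq: "stem_of l ! Suc k = State i"
      using next_node_f[of i] l by (simp add: nth_stem_of)
    have "State i \<in> f ` V" using state by (metis imageI)
    then have "Suc k \<noteq> stem_end l" using stem_end[of l] eq nth_stem_of[of "stem_end l" l] by (metis order_refl)
    then have "Suc k < stem_end l" using l(3) by simp
    then show ?case using l eq state by metis
  qed
  then obtain l i where l: "l \<in> I" "Input l \<in> f ` V" "i < stem_end l" "f j = stem_of l ! i" by blast
  have "j \<in> V" using assms rooted_subset by blast
  then have "State j = stem_of l ! Suc i" using next_node_f[of j] l by (simp add: nth_stem_of)
  then have "State j \<in> set (stem_of l)" using l(3) nth_mem[of "Suc i" "stem_of l"] by (simp add: length_stem_of)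
  then show ?thesis using l by blast
qed

definition period :: "nat \<Rightarrow> nat" where
  "period a = funpow_dist1 prev_state a a"

text \<open>\<open>prev_state\<close> runs against the arcs, hence the reversal. The exponent
  \<open>period a\<close> is included so that \<open>a\<close> stands at both ends.\<close>

definition cycle_of :: "nat \<Rightarrow> node list" where
  "cycle_of a = rev (map (\<lambda>i. State ((prev_state ^^ i) a)) [0..<Suc (period a)])"

lemma period_pos: "period a > 0"
  by (simp add: period_def)

lemma prev_state_period: "(prev_state ^^ period a) a = a"
  unfolding period_def by (rule funpow_dist1_prop[OF self_in_orbit_prev_state])

lemma length_cycle_of: "length (cycle_of a) = Suc (period a)"
  by (simp add: cycle_of_def del: upt_Suc)

lemma nth_cycle_of:
  "i \<le> period a \<Longrightarrow>
    cycle_of a ! i = State ((prev_state ^^ (period a - i)) a)"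
  by (simp add: cycle_of_def rev_nth del: upt_Suc)

lemma set_cycle_of: "set (cycle_of a) = State ` orbit prev_state a"
proof -
  have "set (cycle_of a) = State ` (\<lambda>i. (prev_state ^^ i) a) ` {0..<Suc (period a)}"
    by (simp add: cycle_of_def image_image del: upt_Suc)
  also have "(\<lambda>i. (prev_state ^^ i) a) ` {0..<Suc (period a)} = orbit prev_state a"
    using orbit_conv_funpow_dist1[OF self_in_orbit_prev_state, of a] self_in_orbit_prev_state[of a]
    by (simp only: atLeast0_lessThan_Suc image_insert prev_state_period flip: period_def) (rule insert_absorb)
  finally show ?thesis .
qed

lemma distinct_butlast_cycle_of: "distinct (butlast (cycle_of a))"
proof -
  let ?k = "period a"
  \<comment> \<open>Dropping the last entry of the reversed list drops exponent 0; injectivity of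
    \<open>prev_state\<close> then shifts the exponents back below the period.\<close>
  have "tl [0..<Suc ?k] = map Suc [0..<?k]" by (simp add: map_Suc_upt del: upt_Suc)
  then have "butlast (cycle_of a) = rev (map (\<lambda>i. State ((prev_state ^^ Suc i) a)) [0..<?k])"
    by (simp add: cycle_of_def butlast_rev map_tl[symmetric] comp_def del: upt_Suc)
  moreover have "inj_on (\<lambda>i. State ((prev_state ^^ Suc i) a)) {0..<?k}"
  proof (rule inj_onI)
    fix i j assume i: "i \<in> {0..<?k}" and j: "j \<in> {0..<?k}"
      and "State ((prev_state ^^ Suc i) a) = State ((prev_state ^^ Suc j) a)"
    then have "prev_state ((prev_state ^^ i) a) = prev_state ((prev_state ^^ j) a)" by simp
    then have "(prev_state ^^ i) a = (prev_state ^^ j) a"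
      by (rule injD[OF permutes_inj[OF prev_state_permutes]])
    then show "i = j"
      using inj_onD[OF inj_on_funpow_dist1[OF self_in_orbit_prev_state, folded period_def]] i j by blast
  qed
  ultimately show ?thesis by (simp add: distinct_map)
qed

lemma hd_last_cycle_of: "hd (cycle_of a) = last (cycle_of a)"
proof -
  have "cycle_of a \<noteq> []" using length_cycle_of[of a] by (metis Zero_not_Suc list.size(3))
  then show ?thesis
    using nth_cycle_of[of 0 a] nth_cycle_of[of "period a" a]
    by (simp add: hd_conv_nth last_conv_nth length_cycle_of prev_state_period del: funpow.simps(2))
qed

lemma cycle_of_step:
  assumes a: "a \<in> V - rooted" and i: "Suc i < length (cycle_of a)"
  shows "\<exists>j\<in>V. cycle_of a ! Suc i = State j \<and> f j = cycle_of a ! i"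
proof -
  let ?k = "period a"
  let ?j = "(prev_state ^^ (?k - Suc i)) a"
  have "?j \<in> V - rooted"
    using funpow_in_orbit[OF self_in_orbit_prev_state] orbit_prev_state_subset[OF a] by blast
  moreover from this have "f ?j = State (prev_state ?j)" by (rule prev_state(1))
  moreover have "prev_state ?j = (prev_state ^^ (?k - i)) a"
  proof -
    have "?k - i = Suc (?k - Suc i)" using i by (simp add: length_cycle_of)
    then show ?thesis by simp
  qed
  ultimately show ?thesis using i nth_cycle_of[of i a] nth_cycle_of[of "Suc i" a] 
    by (auto simp: length_cycle_of simp del: funpow.simps(2))
qed

end

text \<open>In a list of at least two nodes every node is an end of an arc, so being a vertex
  follows from the arcs.\<close>

lemma chain_vwalk:
  assumes chain: "\<And>i. Suc i < length p \<Longrightarrow> (p ! i, p ! Suc i) \<in> parcs (system_graph A B)"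
    and A: "A \<in> carrier_mat n n" and B: "B \<in> carrier_mat n m" and len: "length p \<ge> 2"
  shows "vwalk p (system_graph A B)"
  unfolding vwalk_with_proj_iff
proof (intro conjI allI impI subsetI)
  have ends: "v \<in> pverts (system_graph A B) \<and> w \<in> pverts (system_graph A B)"
    if "(v, w) \<in> parcs (system_graph A B)" for v w
    using that A B by (auto simp: system_graph_def state_nodes_def input_nodes_def)
  show "p \<noteq> []" using len by auto
  fix v assume "v \<in> set p"
  then obtain i where i: "i < length p" "v = p ! i" by (auto simp: in_set_conv_nth)
  show "v \<in> pverts (system_graph A B)"
  proof (cases i)
    case 0
    then show ?thesis using i len chain[of 0] ends by auto
  next
    case (Suc k)
    then show ?thesis using i chain[of k] ends by auto
  qed
qed (rule chain)

lemma transversal_predecessor_map: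
  assumes A: "A \<in> carrier_mat n n" and B: "B \<in> carrier_mat n m"
    and inj: "inj_on f {..<n}" and arc: "\<And>j. j < n \<Longrightarrow> (f j, State j) \<in> parcs (system_graph A B)"
  shows "predecessor_map {..<n} {..<m} f"
proof
  fix j assume "j \<in> {..<n}"
  then show "f j \<in> State ` {..<n} \<union> Input ` {..<m}"
    using arc[of j] A B by (auto simp: system_graph_def)
qed (use inj in auto)

lemma transversal_imp_disjoint_cover:
  assumes A: "A \<in> carrier_mat n n" and B: "B \<in> carrier_mat n m"
    and inj: "inj_on f {..<n}" and arc: "\<And>j. j < n \<Longrightarrow> (f j, State j) \<in> parcs (system_graph A B)"
  shows "\<exists>F. (\<forall>p\<in>F. stem A B p \<or> graph_cycle A B p) \<and> covers F (state_nodes A) \<and>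
    (\<forall>p\<in>F. \<forall>c\<in>F. stem A B p \<longrightarrow> graph_cycle A B c \<longrightarrow> set p \<inter> set c = {}) \<and>
    (\<forall>c\<in>F. \<forall>d\<in>F. graph_cycle A B c \<longrightarrow> graph_cycle A B d \<longrightarrow> set c \<inter> set d \<noteq> {} \<longrightarrow> c = d) \<and>
    (\<forall>p\<in>F. \<forall>q\<in>F. stem A B p \<longrightarrow> stem A B q \<longrightarrow> set p \<inter> set q \<noteq> {} \<longrightarrow> p = q)"
proof -
  interpret predecessor_map "{..<n}" "{..<m}" f
    using A B inj arc by (rule transversal_predecessor_map)
  let ?G = "system_graph A B" and ?V = "{..<n}" and ?I = "{..<m}"
  \<comment> \<open>One representative for each orbit, depending on the orbit alone. Otherwise all
    rotations of a cycle would enter the family, and intersecting cycles need not be equal as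
    lists.\<close>
  define rep where "rep = (\<lambda>a. SOME b. b \<in> orbit prev_state a)"
  \<comment> \<open>An input node that precedes no state under \<open>f\<close> is left out: its
    chain is a single node and does not end in a state.\<close>
  define F1 where "F1 = stem_of ` {l \<in> ?I. Input l \<in> f ` ?V}"
  define F2 where "F2 = cycle_of ` {a \<in> ?V - rooted. a = rep a}"
  have stems: "stem A B p" if p: "p \<in> F1" for p
  proof -
    obtain l where l: "l < m" "Input l \<in> f ` ?V" "p = stem_of l" using p by (auto simp: F1_def)
    have "stem_end l \<noteq> 0" using stem_end[of l] l by (metis funpow_0)
    then have len: "length p \<ge> 2" using l by (simp add: length_stem_of)
    have chain: "\<exists>j\<in>?V. p ! Suc i = State j \<and> f j = p ! i" if "Suc i < length p" for i
      using stem_of_step that l by simp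
    have "vwalk p ?G"
      by (rule chain_vwalk[OF _ A B len]) (metis chain arc lessThan_iff)
    moreover have "hd p \<in> input_nodes B" using l B by (simp add: hd_stem_of input_nodes_def)
    moreover have "last p \<in> state_nodes A"
    proof -
      have "p \<noteq> []" "Suc (length p - 2) < length p" "Suc (length p - 2) = length p - 1" using len by auto
      then have "last p \<in> State ` ?V" using chain[of "length p - 2"] by (auto simp: last_conv_nth)
      then show ?thesis using A by (auto simp: state_nodes_def)
    qed
    ultimately show ?thesis using distinct_stem_of[of l] l by (simp add: stem_def vpath_def)
  qed
  have cycles: "graph_cycle A B c" if c: "c \<in> F2" for c
  proof -
    obtain a where a: "a \<in> ?V - rooted" "c = cycle_of a" using c by (auto simp: F2_def)
    have len: "length c \<ge> 2" using a period_pos[of a] by (simp add: length_cycle_of)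
    have "vwalk c ?G"
      by (rule chain_vwalk[OF _ A B len]) (metis cycle_of_step[OF a(1)] a(2) arc lessThan_iff)
    then show ?thesis
      using len a distinct_butlast_cycle_of hd_last_cycle_of by (simp add: graph_cycle_def)
  qed
  have F1: "p \<in> F1" if "p \<in> F1 \<union> F2" "stem A B p" for p
    using that cycles graph_cycle_not_distinct stem_distinct by blast
  have F2: "c \<in> F2" if "c \<in> F1 \<union> F2" "graph_cycle A B c" for c
    using that stems graph_cycle_not_distinct stem_distinct by blast
  have rep_orbit: "orbit prev_state b = orbit prev_state a" if "b \<in> orbit prev_state a" for a b
    using orbit_cyclic_eq3[OF cyclic_on_prev_state that] .
  have rep_in: "rep a \<in> orbit prev_state a" for a
    unfolding rep_def using self_in_orbit_prev_state by (rule someI)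
  have cover: "covers (F1 \<union> F2) (state_nodes A)"
    unfolding covers_def
  proof
    fix x assume "x \<in> state_nodes A"
    then obtain j where j: "j < n" "x = State j" using A by (auto simp: state_nodes_def)
    show "\<exists>p\<in>F1 \<union> F2. x \<in> set p"
    proof (cases "j \<in> rooted")
      case True
      then show ?thesis using rooted_in_stem_of[OF True] j by (auto simp: F1_def)
    next
      case False
      then have jV: "j \<in> ?V - rooted" using j by simp
      have eq: "orbit prev_state (rep j) = orbit prev_state j" using rep_orbit rep_in by blast
      then have "rep j = rep (rep j)" unfolding rep_def by simp
      moreover have "rep j \<in> ?V - rooted" using orbit_prev_state_subset[OF jV] rep_in by blast
      ultimately have "cycle_of (rep j) \<in> F2" by (simp add: F2_def)
      moreover have "x \<in> set (cycle_of (rep j))"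
        unfolding set_cycle_of eq using j self_in_orbit_prev_state by blast
      ultimately show ?thesis by blast
    qed
  qed
  have stem_cycle: "set p \<inter> set c = {}" if p: "p \<in> F1" and c: "c \<in> F2" for p c
  proof -
    obtain l where l: "p = stem_of l" using p by (auto simp: F1_def)
    obtain a where a: "a \<in> ?V - rooted" "c = cycle_of a" using c by (auto simp: F2_def)
    have "set c \<subseteq> State ` (?V - rooted)" using orbit_prev_state_subset[OF a(1)] a(2) set_cycle_of by auto
    then show ?thesis using stem_of_rooted l by auto
  qed
  have cycle_cycle: "c = d" if cd: "c \<in> F2" "d \<in> F2" "set c \<inter> set d \<noteq> {}" for c d
  proof -
    obtain a b where ab: "a = rep a" "c = cycle_of a" "b = rep b" "d = cycle_of b"
      using cd(1,2) by (auto simp: F2_def)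
    obtain w where "w \<in> orbit prev_state a" "w \<in> orbit prev_state b"
      using cd(3) ab(2,4) by (auto simp: set_cycle_of)
    then have "orbit prev_state a = orbit prev_state b" using rep_orbit by metis
    then have "rep a = rep b" unfolding rep_def by simp
    then show ?thesis using ab by simp
  qed
  have stem_stem: "p = q" if pq: "p \<in> F1" "q \<in> F1" "set p \<inter> set q \<noteq> {}" for p q
  proof -
    obtain l l' where l: "p = stem_of l" "q = stem_of l'" using pq(1,2) by (auto simp: F1_def)
    obtain w where "w \<in> set (stem_of l)" "w \<in> set (stem_of l')" using pq(3) l by blast
    then show ?thesis using stem_of_disjoint l by blast
  qed
  show ?thesis
  proof (intro exI[of _ "F1 \<union> F2"] conjI ballI impI)
    show "stem A B p \<or> graph_cycle A B p" if "p \<in> F1 \<union> F2" for p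
      using that stems cycles by blast
    show "set p \<inter> set c = {}"
      if "p \<in> F1 \<union> F2" "c \<in> F1 \<union> F2" "stem A B p" "graph_cycle A B c" for p c
      using F1[OF that(1,3)] F2[OF that(2,4)] by (rule stem_cycle)
    show "c = d" if "c \<in> F1 \<union> F2" "d \<in> F1 \<union> F2" "graph_cycle A B c" "graph_cycle A B d"
      "set c \<inter> set d \<noteq> {}" for c d
      using F2[OF that(1,3)] F2[OF that(2,4)] that(5) by (rule cycle_cycle)
    show "p = q" if "p \<in> F1 \<union> F2" "q \<in> F1 \<union> F2" "stem A B p" "stem A B q"
      "set p \<inter> set q \<noteq> {}" for p q
      using F1[OF that(1,3)] F1[OF that(2,4)] that(5) by (rule stem_stem)
  qed (rule cover)
qed

section \<open>Structural controllability and predecessor maps\<close>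

text \<open>A nonzero entry of a realization sits at a free parameter, so distinct nonzero entries
  in the rows of \<open>[A' B']\<close> are arcs with distinct tails.\<close>

lemma structurally_controllable_imp_transversal:
  assumes A: "A \<in> carrier_mat n n" and B: "B \<in> carrier_mat n m"
    and sc: "structurally_controllable A B"
  shows "\<exists>f. inj_on f {..<n} \<and> (\<forall>j<n. (f j, State j) \<in> parcs (system_graph A B))"
proof -
  obtain A' B' where A': "realizes A' A" and B': "realizes B' B"
    and rank: "full_row_rank (controllability_matrix A' B')"
    using sc unfolding structurally_controllable_def by blast
  have cA: "A' \<in> carrier_mat n n" and cB: "B' \<in> carrier_mat n m"
    using A' B' A B by (auto simp: realizes_def)
  define M where "M = (\<lambda>i v. case v of State k \<Rightarrow> A' $$ (i, k) | Input l \<Rightarrow> B' $$ (i, l))"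
  have "\<exists>f. inj_on f {..<n} \<and> (\<forall>i\<in>{..<n}. f i \<in> State ` {..<n} \<union> Input ` {..<m} \<and> M i (f i) \<noteq> 0)"
  proof (rule independent_rows_transversal)
    fix x i
    assume ker: "\<And>c. c \<in> State ` {..<n} \<union> Input ` {..<m} \<Longrightarrow> (\<Sum>i<n. x i * M i c) = 0"
      and i: "i \<in> {..<n}"
    show "x i = 0"
    proof (rule full_row_rank_left_kernel[OF cA cB rank])
      show "(\<Sum>j<n. A' $$ (j, k) * x j) = 0" if "k < n" for k
        using ker[of "State k"] that by (simp add: M_def mult.commute)
      show "(\<Sum>j<n. B' $$ (j, l) * x j) = 0" if "l < m" for l
        using ker[of "Input l"] that by (simp add: M_def mult.commute)
    qed (use i in simp)
  qed auto
  then obtain f where f: "inj_on f {..<n}"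
    "\<And>i. i < n \<Longrightarrow> f i \<in> State ` {..<n} \<union> Input ` {..<m} \<and> M i (f i) \<noteq> 0" by blast
  have "(f i, State i) \<in> parcs (system_graph A B)" if "i < n" for i
    using f(2)[OF that] that A B A' B' by (auto simp: M_def realizes_def system_graph_def)
  then show ?thesis using f(1) by blast
qed

lemma accessible_arc_into_complement:
  assumes A: "A \<in> carrier_mat n n" and B: "B \<in> carrier_mat n m"
    and acc: "input_accessible A B" and S: "S \<subset> {..<n}"
  shows "\<exists>s \<in> State ` S \<union> Input ` {..<m}. \<exists>a \<in> {..<n} - S. (s, State a) \<in> parcs (system_graph A B)"
proof -
  let ?Q = "State ` S \<union> Input ` {..<m}"
  obtain j where j: "j < n" "j \<notin> S" using S by auto
  then obtain p where p: "stem A B p" "last p = State j"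
    using acc A by (auto simp: input_accessible_def state_nodes_def)
  have walk: "vwalk p (system_graph A B)" and hd: "hd p \<in> ?Q"
    using p B by (auto simp: stem_def input_nodes_def)
  then have p0: "p \<noteq> []" by (auto simp: vwalk_def)
  \<comment> \<open>The stem starts in \<open>?Q\<close> and ends outside it. Its first node outside
    is entered from \<open>?Q\<close>, and as the head of an arc it is a state.\<close>
  define k where "k = (LEAST k. k < length p \<and> p ! k \<notin> ?Q)"
  have "length p - 1 < length p \<and> p ! (length p - 1) \<notin> ?Q"
    using p0 p(2) j by (auto simp: last_conv_nth)
  then have k: "k < length p \<and> p ! k \<notin> ?Q" unfolding k_def by (rule LeastI)
  have "k \<noteq> 0" using k hd p0 by (metis hd_conv_nth)
  then obtain i where i: "k = Suc i" using not0_implies_Suc by blast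
  have "p ! i \<in> ?Q"
    using not_less_Least[of i "\<lambda>k. k < length p \<and> p ! k \<notin> ?Q"] k i unfolding k_def[symmetric] by auto
  moreover have arc: "(p ! i, p ! k) \<in> parcs (system_graph A B)"
    using walk k i unfolding vwalk_with_proj_iff by blast
  moreover obtain a where a: "a < n" "p ! k = State a"
    using arc A B by (auto simp: system_graph_def)
  moreover have "a \<notin> S" using k a by auto
  ultimately show ?thesis by (intro bexI[of _ "p ! i"] bexI[of _ a]) auto
qed

lemma transversal_imp_structurally_controllable:
  assumes A: "A \<in> carrier_mat n n" and B: "B \<in> carrier_mat n m" and acc: "input_accessible A B"
    and inj: "inj_on f {..<n}" and arc: "\<And>j. j < n \<Longrightarrow> (f j, State j) \<in> parcs (system_graph A B)"
  shows "structurally_controllable A B"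
proof -
  interpret predecessor_map "{..<n}" "{..<m}" f
    using A B inj arc by (rule transversal_predecessor_map)
  obtain W where W: "\<And>v j. W v j \<noteq> 0 \<Longrightarrow> (v, State j) \<in> parcs (system_graph A B)"
    and ctrb: "controllable_on {..<n} {..<m} W"
    using controllable_on_weights_exist[of "\<lambda>v j. (v, State j) \<in> parcs (system_graph A B)"]
      arc accessible_arc_into_complement[OF A B acc] by auto
  have "realizes (mat n n (\<lambda>(j, i). W (State i) j)) A" "realizes (mat n m (\<lambda>(j, l). W (Input l) j)) B"
    using A B W by (auto simp: realizes_def system_graph_def)
  then show ?thesis
    using controllable_on_imp_full_row_rank[OF ctrb] unfolding structurally_controllable_def by blast
qed

theorem corollary1:
  fixes n m :: nat and A B :: "bool mat"
  assumes "network_system n m A B"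
    and "input_accessible A B"
  shows "\<not> structurally_controllable A B \<longleftrightarrow>
    (\<forall>F. (\<forall>p\<in>F. stem A B p \<or> graph_cycle A B p) \<and> covers F (state_nodes A) \<longrightarrow>
       (\<exists>p\<in>F. \<exists>c\<in>F. stem A B p \<and> graph_cycle A B c \<and> (\<exists>w. w \<in> set p \<and> w \<in> set c))
     \<or> (\<exists>c\<in>F. \<exists>d\<in>F. graph_cycle A B c \<and> graph_cycle A B d \<and> \<not> same_cycle c d \<and>
          (\<exists>w. w \<in> set c \<and> w \<in> set d))
     \<or> (\<exists>p\<in>F. \<exists>q\<in>F. stem A B p \<and> stem A B q \<and> p \<noteq> q \<and> hd p \<noteq> hd q \<and>
          (\<exists>w. w \<in> set p \<and> w \<in> set q))
     \<or> (\<exists>p\<in>F. \<exists>q\<in>F. stem A B p \<and> stem A B q \<and> p \<noteq> q \<and> hd p = hd q))"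
    (is "_ \<longleftrightarrow> (\<forall>F. ?cover F \<longrightarrow> ?m1 F \<or> ?m2 F \<or> ?m3 F \<or> ?m4 F)")
proof -
  have A: "A \<in> carrier_mat n n" and B: "B \<in> carrier_mat n m"
    using assms(1) by (auto simp: network_system_def)
  have "\<not> (?m1 F \<or> ?m2 F \<or> ?m3 F \<or> ?m4 F)"
    if stem_cycle: "\<forall>p\<in>F. \<forall>c\<in>F. stem A B p \<longrightarrow> graph_cycle A B c \<longrightarrow> set p \<inter> set c = {}"
      and cycles: "\<forall>c\<in>F. \<forall>d\<in>F. graph_cycle A B c \<longrightarrow> graph_cycle A B d \<longrightarrow> set c \<inter> set d \<noteq> {} \<longrightarrow> c = d"
      and stems: "\<forall>p\<in>F. \<forall>q\<in>F. stem A B p \<longrightarrow> stem A B q \<longrightarrow> set p \<inter> set q \<noteq> {} \<longrightarrow> p = q"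
    for F
  proof (rule notI, elim disjE bexE conjE exE)
    fix p c w
    assume "p \<in> F" "c \<in> F" "stem A B p" "graph_cycle A B c" "w \<in> set p" "w \<in> set c"
    then show False using stem_cycle by blast
  next
    fix c d w
    assume cd: "c \<in> F" "d \<in> F" "graph_cycle A B c" "graph_cycle A B d" "\<not> same_cycle c d"
      and w: "w \<in> set c" "w \<in> set d"
    have "set c \<inter> set d \<noteq> {}" using w by blast
    then have "c = d" using cycles cd by blast
    moreover have "same_cycle c c" unfolding same_cycle_def by (intro exI[of _ 0]) simp
    ultimately show False using cd by simp
  next
    fix p q w
    assume pq: "p \<in> F" "q \<in> F" "stem A B p" "stem A B q" "p \<noteq> q" and w: "w \<in> set p" "w \<in> set q"
    have "set p \<inter> set q \<noteq> {}" using w by blast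
    then show False using stems pq by blast
  next
    fix p q
    assume pq: "p \<in> F" "q \<in> F" "stem A B p" "stem A B q" "p \<noteq> q" and hd: "hd p = hd q"
    \<comment> \<open>Stems with the same origin meet at that origin, so the fourth pattern is an
      intersection as well.\<close>
    have "hd p \<in> set p" "hd p \<in> set q"
      using pq(3,4) hd hd_in_set[of p] hd_in_set[of q] unfolding stem_def vpath_def vwalk_def by auto
    then have "set p \<inter> set q \<noteq> {}" by blast
    then show False using stems pq by blast
  qed
  note disjoint_family = this
  have "structurally_controllable A B \<longleftrightarrow> (\<exists>F. ?cover F \<and> \<not> (?m1 F \<or> ?m2 F \<or> ?m3 F \<or> ?m4 F))"
  proof
    assume "structurally_controllable A B"
    then obtain f where f: "inj_on f {..<n}" "\<And>j. j < n \<Longrightarrow> (f j, State j) \<in> parcs (system_graph A B)"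
      using structurally_controllable_imp_transversal[OF A B] by blast
    obtain F where F: "\<forall>p\<in>F. stem A B p \<or> graph_cycle A B p" "covers F (state_nodes A)"
      and "\<forall>p\<in>F. \<forall>c\<in>F. stem A B p \<longrightarrow> graph_cycle A B c \<longrightarrow> set p \<inter> set c = {}"
        "\<forall>c\<in>F. \<forall>d\<in>F. graph_cycle A B c \<longrightarrow> graph_cycle A B d \<longrightarrow> set c \<inter> set d \<noteq> {} \<longrightarrow> c = d"
        "\<forall>p\<in>F. \<forall>q\<in>F. stem A B p \<longrightarrow> stem A B q \<longrightarrow> set p \<inter> set q \<noteq> {} \<longrightarrow> p = q"
      by (rule exE[OF transversal_imp_disjoint_cover[OF A B f(1)]]) (erule f(2), elim conjE, rule that)
    from this(3-) have "\<not> (?m1 F \<or> ?m2 F \<or> ?m3 F \<or> ?m4 F)" by (rule disjoint_family)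
    then show "\<exists>F. ?cover F \<and> \<not> (?m1 F \<or> ?m2 F \<or> ?m3 F \<or> ?m4 F)"
      using F by (intro exI[of _ F] conjI)
  next
    assume "\<exists>F. ?cover F \<and> \<not> (?m1 F \<or> ?m2 F \<or> ?m3 F \<or> ?m4 F)"
    then obtain F where mem: "\<forall>p\<in>F. stem A B p \<or> graph_cycle A B p" and cover: "covers F (state_nodes A)"
      and n1: "\<not> ?m1 F" and n2: "\<not> ?m2 F" and n3: "\<not> ?m3 F" and n4: "\<not> ?m4 F"
      unfolding de_Morgan_disj by (elim exE conjE) (rule that)
    have "\<exists>f. inj_on f {..<dim_row A} \<and> (\<forall>j<dim_row A. (f j, State j) \<in> parcs (system_graph A B))"
    proof (rule disjoint_cover_imp_transversal[OF _ cover])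
      show "stem A B p \<or> graph_cycle A B p" if "p \<in> F" for p
        using mem that by (rule bspec)
      show "set p \<inter> set c = {}"
        if "p \<in> F" "c \<in> F" "stem A B p" "graph_cycle A B c" for p c
        using n1 that by blast
      show "same_cycle c d" if "c \<in> F" "d \<in> F" "graph_cycle A B c" "graph_cycle A B d"
        "set c \<inter> set d \<noteq> {}" for c d
        using n2 that by blast
      \<comment> \<open>Distinct stems that meet have either different origins, excluded by
        \<open>n3\<close>, or the same one, excluded by \<open>n4\<close>.\<close>
      show "p = q" if "p \<in> F" "q \<in> F" "stem A B p" "stem A B q" "set p \<inter> set q \<noteq> {}" for p q
        using n3 n4 that by blast
    qed
    then show "structurally_controllable A B"
      using A transversal_imp_structurally_controllable[OF A B assms(2)] by auto
  qed
  moreover have "\<not> (\<exists>F. P F \<and> \<not> Q F) \<longleftrightarrow> (\<forall>F. P F \<longrightarrow> Q F)" for P Q :: "node list set \<Rightarrow> bool"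
    by blast
  ultimately show ?thesis by (simp only:)
qed

end
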